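(* A probability measure on $\{0,1,2,\dots\}$ is t-stable (transcendental stable) if and only if it is the distribution of a (possibly infinite) sum of independent Bernoulli random variables and a Poisson random variable, all independent.
   Context: A polynomial $f\in\mathbb{C}[x]$ is stable if $f(x)\neq 0$ whenever $\operatorname{Im}(x)>0$. A function $f$ on $\mathbb{C}$ is t-stable (transcendental stable) if there are stable polynomials $f_m$ with $f_m\to f$ uniformly on all compact subsets of $\mathbb{C}$. A probability measure $\mu$ on $\{0,1,2,\dots\}$ is t-stable if its generating function $\sum_{k\ge 0}\mu(k)x^k$ is (the power series of) a t-stable function on $\mathbb{C}$. Bernoulli parameters range over $[0,1]$ (so non-negative integer constants are allowed as sums of Bernoulli variables), and the Poisson parameter ranges over $[0,\infty)$ (parameter $0$ meaning the constant $0$). An infinite sum is understood to be almost surely finite. *)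

theory Defs
  imports "HOL-Probability.Probability" "HOL-Computational_Algebra.Polynomial"
begin

definition stable_poly :: "complex poly \<Rightarrow> bool" where
  "stable_poly p \<longleftrightarrow> (\<forall>x. Im x > 0 \<longrightarrow> poly p x \<noteq> 0)"

definition t_stable :: "(complex \<Rightarrow> complex) \<Rightarrow> bool" where
  "t_stable f \<longleftrightarrow> (\<exists>p :: nat \<Rightarrow> complex poly. (\<forall>m. stable_poly (p m)) \<and>
     (\<forall>K. compact K \<longrightarrow> uniform_limit K (\<lambda>m x. poly (p m) x) f sequentially))"

text \<open>Probability measures on the natural numbers are elements of \<^typ>\<open>nat pmf\<close>. The
  generating function is a priori only known to converge on the unit disc, so its convergence
  to the t-stable function on all of the complex plane is part of the definition.\<close>

definition t_stable_pmf :: "nat pmf \<Rightarrow> bool" where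
  "t_stable_pmf \<mu> \<longleftrightarrow>
     (\<exists>f. t_stable f \<and> (\<forall>x. (\<lambda>k. complex_of_real (pmf \<mu> k) * x ^ k) sums f x))"

definition has_law :: "'a measure \<Rightarrow> ('a \<Rightarrow> nat) \<Rightarrow> nat pmf \<Rightarrow> bool" where
  "has_law M Z \<mu> \<longleftrightarrow> Z \<in> measurable M (count_space UNIV) \<and>
     distr M (count_space UNIV) Z = measure_pmf \<mu>"

definition bernoulli_rv :: "'a measure \<Rightarrow> ('a \<Rightarrow> nat) \<Rightarrow> bool" where
  "bernoulli_rv M Z \<longleftrightarrow> (\<exists>p\<in>{0..1}. has_law M Z (map_pmf of_bool (bernoulli_pmf p)))"

text \<open>The library's \<^const>\<open>poisson_pmf\<close> is only specified for positive rates; rate 0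
  is the point mass at 0.\<close>

definition poisson_rv :: "'a measure \<Rightarrow> ('a \<Rightarrow> nat) \<Rightarrow> bool" where
  "poisson_rv M Z \<longleftrightarrow>
     (\<exists>r\<ge>0. has_law M Z (if r = 0 then return_pmf 0 else poisson_pmf r))"

text \<open>The index set \<open>I\<close> may be empty, finite or infinite. The joint family is indexed by
  options: \<open>None\<close> stands for \<open>Y\<close> and \<open>Some i\<close> for \<open>X i\<close>. Summability is
  taken in the discrete space of natural numbers, so the almost-everywhere condition says that
  the sum is almost surely finite.\<close>

definition bernoulli_poisson_sum ::
  "'a measure \<Rightarrow> nat set \<Rightarrow> (nat \<Rightarrow> 'a \<Rightarrow> nat) \<Rightarrow> ('a \<Rightarrow> nat) \<Rightarrow> nat pmf \<Rightarrow> bool" where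
  "bernoulli_poisson_sum M I X Y \<mu> \<longleftrightarrow>
     prob_space M \<and>
     (\<forall>i\<in>I. bernoulli_rv M (X i)) \<and>
     poisson_rv M Y \<and>
     prob_space.indep_vars M (\<lambda>_. count_space UNIV) (case_option Y X) (insert None (Some ` I)) \<and>
     (AE \<omega> in M. (\<lambda>i. X i \<omega>) summable_on I) \<and>
     has_law M (\<lambda>\<omega>. (\<Sum>\<^sub>\<infinity>i\<in>I. X i \<omega>) + Y \<omega>) \<mu>"

end

theory Submission
  imports Defs "HOL-Complex_Analysis.Complex_Analysis"
    "HOL-Computational_Algebra.Fundamental_Theorem_Algebra"
begin

text \<open>
  Every factor \<open>1 + p (x - 1)\<close> with \<open>0 \<le> p \<le> 1\<close> has at most one zero, and that zero is real; it is
  the generating function of a Bernoulli variable. Likewise \<open>exp (r (x - 1))\<close> is the generating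
  function of a Poisson variable and the locally uniform limit of \<open>(1 + r (x - 1) / n) ^ n\<close>.

  From a Bernoulli-Poisson sum to stability: by independence and dominated convergence the
  generating function is \<open>\<Prod>\<^sub>i (1 + p\<^sub>i (x - 1)) exp (r (x - 1))\<close> on the unit disc. Its value at
  \<open>1/2\<close> is positive because the sum is almost surely finite, and this forces \<open>\<Sum>\<^sub>i p\<^sub>i < \<infinity>\<close>. The
  product therefore converges locally uniformly on the whole plane to a t-stable entire function,
  whose Taylor coefficients are the probabilities.

  From stability to a Bernoulli-Poisson sum: let stable polynomials \<open>p\<^sub>m\<close> converge to the generating
  function of \<open>\<mu>\<close>. The differential operator \<open>p\<^sub>m(-d/dx)\<close> preserves stability unless its result
  vanishes (\<open>poly_neg_deriv_stable\<close>). Applied to \<open>x ^ n\<close>, it yields in the limit, by Hurwitz'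
  theorem and after the substitution \<open>x \<mapsto> - n / x\<close>, that the polynomial
  \<open>\<Sum>\<^sub>k \<mu>(k) (1 - 0/n) (1 - 1/n) \<dots> (1 - (k-1)/n) x ^ k\<close> has no zero in the upper half-plane
  (\<open>jensen_poly_root_nonpos_real\<close>). Its coefficients are non-negative, so all its zeros are real and
  at most zero; normalised to have value \<open>1\<close> at \<open>1\<close>, it is thus a finite product of Bernoulli
  generating functions. These polynomials converge to the generating function of \<open>\<mu>\<close>. List the
  parameters of the \<open>n\<close>-th product in decreasing order \<open>p\<^sub>n\<^sub>0 \<ge> p\<^sub>n\<^sub>1 \<ge> \<dots>\<close>. Their sums stay bounded,
  hence \<open>p\<^sub>n\<^sub>i \<le> M / (i + 1)\<close>, and along a subsequence every \<open>p\<^sub>n\<^sub>i\<close> tends to some \<open>q\<^sub>i\<close>. The linear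
  parts of \<open>ln (1 + p\<^sub>n\<^sub>i (x - 1))\<close> may lose mass in the limit, which is where the Poisson factor
  comes from; the remainders are quadratic, so they are dominated by a multiple of \<open>1 / (i + 1)\<^sup>2\<close>
  and pass to the limit term by term (\<open>bernoulli_products_limit\<close>). Finally independent variables
  with the parameters found are realised on a product space, and their sum has law \<open>\<mu>\<close> because the
  generating functions agree.
\<close>

section \<open>Stable polynomials\<close>

lemma stable_poly_nonzero: "stable_poly p \<Longrightarrow> p \<noteq> 0"
  unfolding stable_poly_def by (metis imaginary_unit.sel(2) poly_0 zero_less_one)

lemma stable_poly_smult: "c \<noteq> 0 \<Longrightarrow> stable_poly p \<Longrightarrow> stable_poly (smult c p)"
  by (simp add: stable_poly_def)

lemma stable_poly_mult_iff: "stable_poly (p * q) \<longleftrightarrow> stable_poly p \<and> stable_poly q"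
  by (auto simp: stable_poly_def)

lemma stable_poly_linear_iff: "stable_poly [:-a, 1:] \<longleftrightarrow> Im a \<le> 0"
  unfolding stable_poly_def by (auto simp: not_less[symmetric])

lemma stable_poly_prod: "(\<And>i. i \<in> A \<Longrightarrow> stable_poly (p i)) \<Longrightarrow> stable_poly (\<Prod>i\<in>A. p i)"
  by (induction A rule: infinite_finite_induct) (auto simp: stable_poly_mult_iff, simp_all add: stable_poly_def)

lemma stable_poly_power: "stable_poly p \<Longrightarrow> stable_poly (p ^ n)"
  by (simp add: stable_poly_def)

lemma stable_poly_induct [consumes 1, case_names const root]:
  assumes "stable_poly p"
    and const: "\<And>c. c \<noteq> 0 \<Longrightarrow> P [:c:]"
    and root: "\<And>a q. Im a \<le> 0 \<Longrightarrow> stable_poly q \<Longrightarrow> P q \<Longrightarrow> P ([:-a, 1:] * q)"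
  shows "P p"
  using assms(1)
proof (induction "degree p" arbitrary: p)
  case 0
  then obtain c where "p = [:c:]" by (metis degree_eq_zeroE)
  with stable_poly_nonzero[OF 0(2)] const[of c] show ?case by simp
next
  case (Suc n)
  then obtain a where "poly p a = 0" using alg_closed_imp_poly_has_root[of p] by auto
  then obtain q where q: "p = [:-a, 1:] * q" by (metis dvdE poly_eq_0_iff_dvd)
  with Suc.prems have sq: "Im a \<le> 0" "stable_poly q"
    unfolding q stable_poly_mult_iff stable_poly_linear_iff by auto
  have "degree p = Suc (degree q)"
    unfolding q using stable_poly_nonzero[OF sq(2)] by (subst degree_mult_eq) auto
  with Suc sq q root show ?case by auto
qed

text \<open>
  The logarithmic derivative is \<open>\<Sum> 1 / (z - a)\<close> over the zeros \<open>a\<close>. Each \<open>z - a\<close> lies in the upper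
  half-plane, so each reciprocal lies in the lower one.
\<close>

lemma stable_poly_logderiv:
  assumes "stable_poly p" "Im z > 0"
  shows "if degree p = 0 then poly (pderiv p) z = 0 else Im (poly (pderiv p) z / poly p z) < 0"
  using assms(1)
proof (induction rule: stable_poly_induct)
  case (const c)
  then show ?case by simp
next
  case (root a q)
  have "q \<noteq> 0" using root stable_poly_nonzero by blast
  then have deg: "degree ([:-a, 1:] * q) = Suc (degree q)"
    by (subst degree_mult_eq) auto
  have nz: "z - a \<noteq> 0" "poly q z \<noteq> 0"
    using root assms(2) by (auto simp: stable_poly_def)
  have "pderiv ([:-a, 1:] * q) = [:-a, 1:] * pderiv q + q"
    by (simp only: pderiv_mult) (simp add: pderiv_pCons)
  then have "poly (pderiv ([:-a, 1:] * q)) z = (z - a) * poly (pderiv q) z + poly q z"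
    by (simp only: poly_add poly_mult) simp
  then have eq: "poly (pderiv ([:-a, 1:] * q)) z / poly ([:-a, 1:] * q) z
      = 1 / (z - a) + poly (pderiv q) z / poly q z"
    using nz by (simp add: field_simps)
  have "Im (1 / (z - a)) < 0"
    using root assms(2) nz(1)
    by (auto simp: Im_divide divide_less_0_iff complex_eq_iff sum_power2_gt_zero_iff)
  moreover have "Im (poly (pderiv q) z / poly q z) \<le> 0"
    using root.IH by (auto split: if_splits)
  ultimately show ?case using eq deg by simp
qed

text \<open>
  For non-constant \<open>g\<close>, a zero \<open>z\<close> of \<open>g' + a g\<close> in the upper half-plane would give \<open>g'/g = -a\<close>
  there, where the left-hand side has negative imaginary part and the right-hand side does not.
\<close>

lemma stable_poly_pderiv_add_smult:
  assumes "stable_poly g" "Im a \<le> 0"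
  shows "pderiv g + smult a g = 0 \<or> stable_poly (pderiv g + smult a g)"
proof (cases "degree g = 0")
  case True
  then have "pderiv g = 0" by (simp add: pderiv_eq_0_iff)
  then show ?thesis using assms stable_poly_smult by (cases "a = 0") auto
next
  case False
  have "poly (pderiv g + smult a g) z \<noteq> 0" if "Im z > 0" for z
  proof
    assume "poly (pderiv g + smult a g) z = 0"
    moreover have "poly g z \<noteq> 0" using assms that by (simp add: stable_poly_def)
    ultimately have "poly (pderiv g) z / poly g z = - a"
      by (simp add: field_simps eq_neg_iff_add_eq_0)
    with stable_poly_logderiv[OF assms(1) that] False assms(2) show False by simp
  qed
  then show ?thesis by (simp add: stable_poly_def)
qed

section \<open>Differential operators that preserve stability\<close>

text \<open>
  This is \<open>p(-d/dx) f\<close>. The sign makes a linear factor \<open>x - a\<close> of \<open>p\<close> act as \<open>-(d/dx + a)\<close>, so that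
  zeros \<open>a\<close> in the closed lower half-plane are precisely of the kind that
  \<open>stable_poly_pderiv_add_smult\<close> covers.
\<close>

definition poly_neg_deriv :: "'a::{comm_ring_1,ring_no_zero_divisors} poly \<Rightarrow> 'a poly \<Rightarrow> 'a poly" where
  "poly_neg_deriv p f = (\<Sum>k\<le>degree p. smult ((-1) ^ k * coeff p k) ((pderiv ^^ k) f))"

lemma poly_neg_deriv_altdef:
  assumes "degree p \<le> n"
  shows "poly_neg_deriv p f = (\<Sum>k\<le>n. smult ((-1) ^ k * coeff p k) ((pderiv ^^ k) f))"
  unfolding poly_neg_deriv_def
  by (rule sum.mono_neutral_left) (use assms in \<open>auto simp: coeff_eq_0\<close>)

lemma pderiv_sum: "pderiv (\<Sum>i\<in>A. f i) = (\<Sum>i\<in>A. pderiv (f i))"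
  by (induction A rule: infinite_finite_induct) (simp_all add: pderiv_add)

lemma smult_sum_right: "smult c (\<Sum>i\<in>A. f i) = (\<Sum>i\<in>A. smult c (f i))"
  by (induction A rule: infinite_finite_induct) (simp_all add: smult_add_right)

lemma poly_neg_deriv_linear_mult:
  fixes q :: "'a::{comm_ring_1,ring_no_zero_divisors} poly"
  shows "poly_neg_deriv ([:-a, 1:] * q) f = - (pderiv (poly_neg_deriv q f) + smult a (poly_neg_deriv q f))"
proof -
  define n where "n = degree q"
  let ?D = "\<lambda>k. (pderiv ^^ k) f"
  have d: "degree ([:-a, 1:] * q) \<le> Suc n"
    using degree_mult_le[of "[:-a,1:]" q] by (simp add: n_def)
  have c: "coeff ([:-a, 1:] * q) k = (case k of 0 \<Rightarrow> 0 | Suc j \<Rightarrow> coeff q j) - a * coeff q k" for k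
    by (simp add: coeff_pCons split: nat.splits)
  have T: "poly_neg_deriv q f = (\<Sum>k\<le>Suc n. smult ((-1) ^ k * coeff q k) (?D k))"
    by (rule poly_neg_deriv_altdef) (simp add: n_def)
  have "poly_neg_deriv ([:-a, 1:] * q) f =
      (\<Sum>k\<le>Suc n. smult ((-1) ^ k * (case k of 0 \<Rightarrow> 0 | Suc j \<Rightarrow> coeff q j)) (?D k))
       - smult a (poly_neg_deriv q f)"
    unfolding poly_neg_deriv_altdef[OF d] T c smult_sum_right sum_subtractf[symmetric]
    by (intro sum.cong refl) (simp add: algebra_simps smult_diff_left[symmetric])
  also have "(\<Sum>k\<le>Suc n. smult ((-1) ^ k * (case k of 0 \<Rightarrow> 0 | Suc j \<Rightarrow> coeff q j)) (?D k))
      = - pderiv (poly_neg_deriv q f)"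
    unfolding sum.atMost_Suc_shift poly_neg_deriv_def n_def[symmetric] pderiv_sum
    by (simp add: pderiv_smult sum_negf)
  finally show ?thesis by simp
qed

text \<open>
  The operator of a product is the composition of the operators of its linear factors, each of which
  preserves stability. The result may vanish, for instance when \<open>p\<close> is a high power of \<open>x\<close>.
\<close>

lemma poly_neg_deriv_stable:
  assumes "stable_poly p" "stable_poly f"
  shows "poly_neg_deriv p f = 0 \<or> stable_poly (poly_neg_deriv p f)"
  using assms(1)
proof (induction rule: stable_poly_induct)
  case (const c)
  then show ?case using assms(2) by (simp add: poly_neg_deriv_def stable_poly_smult)
next
  case (root a q)
  have neg: "stable_poly (- h)" if "stable_poly h" for h
    using that by (simp add: stable_poly_def)
  show ?case
  proof (cases "poly_neg_deriv q f = 0")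
    case True
    then show ?thesis by (simp only: poly_neg_deriv_linear_mult) simp
  next
    case False
    with root have "stable_poly (poly_neg_deriv q f)" by blast
    from stable_poly_pderiv_add_smult[OF this root(1)] neg show ?thesis
      by (auto simp only: poly_neg_deriv_linear_mult neg_equal_0_iff_equal)
  qed
qed

lemma higher_pderiv_monom_falling:
  "(pderiv ^^ k) (monom (1::'a::field_char_0) n) = (if k \<le> n then monom (fact n / fact (n - k)) (n - k) else 0)"
proof (induction k)
  case (Suc k)
  show ?case
  proof (cases "Suc k \<le> n")
    case True
    then have "n - k = Suc (n - Suc k)" by simp
    with True Suc show ?thesis by (simp add: pderiv_monom field_simps del: of_nat_Suc)
  next
    case False
    then show ?thesis using Suc by (cases "k = n") (auto simp: pderiv_monom)
  qed
qed simp

lemma poly_neg_deriv_monom: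
  fixes p :: "'a::field_char_0 poly"
  shows "poly_neg_deriv p (monom 1 n) =
    (\<Sum>k\<le>n. monom ((-1) ^ k * coeff p k * (fact n / fact (n - k))) (n - k))"
proof -
  have "poly_neg_deriv p (monom 1 n) = (\<Sum>k\<le>degree p + n. smult ((-1) ^ k * coeff p k) ((pderiv ^^ k) (monom 1 n)))"
    by (rule poly_neg_deriv_altdef) simp
  also have "\<dots> = (\<Sum>k\<le>n. smult ((-1) ^ k * coeff p k) ((pderiv ^^ k) (monom 1 n)))"
    by (rule sum.mono_neutral_right) (auto simp: higher_pderiv_monom_falling)
  finally show ?thesis
    by (simp add: higher_pderiv_monom_falling smult_monom)
qed

section \<open>Limits of power series and of stable polynomials\<close>

text \<open>
  A power series that vanishes on \<open>(0, 1)\<close> has constant term \<open>0\<close> by continuity, and any other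
  non-zero coefficient would make \<open>0\<close> an isolated zero.
\<close>

lemma power_series_coeffs_unique:
  fixes a b :: "nat \<Rightarrow> 'a::{real_normed_field,banach}"
  assumes a: "\<And>x. norm x < 1 \<Longrightarrow> (\<lambda>n. a n * x ^ n) sums f x"
    and b: "\<And>x. norm x < 1 \<Longrightarrow> (\<lambda>n. b n * x ^ n) sums g x"
    and eq: "\<And>t::real. 0 < t \<Longrightarrow> t < 1 \<Longrightarrow> f (of_real t) = g (of_real t)"
  shows "a = b"
proof -
  define c h where "c n = a n - b n" and "h x = f x - g x" for n x
  have c: "(\<lambda>n. c n * x ^ n) sums h x" if "norm x < 1" for x
    using sums_diff[OF a[OF that] b[OF that]] by (simp add: c_def h_def algebra_simps)
  have h: "h (of_real t) = 0" if "0 < t" "t < 1" for t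
    using eq[OF that] by (simp add: h_def)
  have "(h \<longlongrightarrow> c 0) (at 0)"
    by (rule powser_limit_0[of 1]) (use c in auto)
  moreover have "filterlim (\<lambda>n. of_real (1 / real (n + 2)) :: 'a) (at 0) sequentially"
  proof (rule filterlim_atI)
    have "(\<lambda>n. 1 / real (n + 2)) \<longlonglongrightarrow> 0"
      by (rule LIMSEQ_ignore_initial_segment[OF lim_1_over_n])
    from tendsto_of_real[OF this]
    show "(\<lambda>n. of_real (1 / real (n + 2)) :: 'a) \<longlonglongrightarrow> 0" by (simp only: of_real_0)
    show "\<forall>\<^sub>F n in sequentially. (of_real (1 / real (n + 2)) :: 'a) \<noteq> 0"
      by (intro always_eventually allI) (simp only: of_real_eq_0_iff, simp)
  qed
  ultimately have "(\<lambda>n. h (of_real (1 / real (n + 2)))) \<longlonglongrightarrow> c 0"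
    by (rule filterlim_compose)
  moreover have "h (of_real (1 / real (n + 2))) = 0" for n
    by (rule h) auto
  ultimately have c0: "c 0 = 0"
    by (simp add: LIMSEQ_const_iff)
  have "c n = 0" for n
  proof (rule ccontr)
    assume n: "c n \<noteq> 0"
    have h0: "h 0 = 0" using c[of 0] c0 by simp
    obtain s where s: "0 < s" "\<And>z. z \<in> cball 0 s - {0} \<Longrightarrow> h z \<noteq> 0"
      using powser_0_nonzero[of 1 0 c h n] c h0 n c0 by (metis diff_zero gr0I zero_less_one)
    define t where "t = min s (1/2)"
    have "0 < t" "t < 1" "of_real t \<in> cball (0::'a) s - {0}"
      using s(1) by (auto simp: t_def)
    with s(2) h show False by blast
  qed
  then show ?thesis by (auto simp: c_def fun_eq_iff)
qed

lemma poly_sums_coeff: "(\<lambda>k. coeff p k * x ^ k) sums poly p x"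
  for p :: "'a::{comm_semiring_0,real_normed_algebra_1} poly"
  unfolding poly_altdef by (rule sums_finite) (auto simp: coeff_eq_0)

text \<open>
  Cauchy's inequality on the unit circle bounds every coefficient of \<open>p m - f\<close> by the supremum of
  \<open>p m - f\<close> there.
\<close>

lemma tendsto_coeff_of_uniform_limit:
  fixes p :: "nat \<Rightarrow> complex poly"
  assumes lim: "uniform_limit (cball 0 1) (\<lambda>m x. poly (p m) x) f sequentially"
    and f: "\<And>x. (\<lambda>k. a k * x ^ k) sums f x"
  shows "(\<lambda>m. coeff (p m) k) \<longlonglongrightarrow> a k"
proof (rule LIMSEQ_I)
  fix e :: real assume "0 < e"
  then have "eventually (\<lambda>m. \<forall>x\<in>cball 0 1. dist (poly (p m) x) (f x) < e / 2) sequentially"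
    using lim[unfolded uniform_limit_iff, rule_format, of "e / 2"] by simp
  then obtain N where N: "\<And>m x. m \<ge> N \<Longrightarrow> x \<in> cball 0 1 \<Longrightarrow> dist (poly (p m) x) (f x) < e / 2"
    unfolding eventually_sequentially by blast
  have "norm (coeff (p m) k - a k) < e" if "m \<ge> N" for m
  proof -
    define h where "h x = poly (p m) x - f x" for x
    have sums: "(\<lambda>k. (coeff (p m) k - a k) * x ^ k) sums h x" for x
      using sums_diff[OF poly_sums_coeff f, of "p m" x] by (simp add: h_def algebra_simps)
    have hol: "h holomorphic_on ball 0 2"
      by (rule power_series_holomorphic[where a = "\<lambda>k. coeff (p m) k - a k"]) (use sums in simp)
    have "(\<lambda>n. (deriv ^^ n) h 0 / fact n) = (\<lambda>k. coeff (p m) k - a k)"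
    proof (rule power_series_coeffs_unique)
      fix x :: complex assume "norm x < 1"
      then show "(\<lambda>n. (deriv ^^ n) h 0 / fact n * x ^ n) sums h x"
        using holomorphic_power_series[OF hol, of x] by simp
    qed (use sums in auto)
    then have k: "(deriv ^^ k) h 0 / fact k = coeff (p m) k - a k" by metis
    have "norm ((deriv ^^ k) h 0) \<le> fact k * (e / 2) / 1 ^ k"
    proof (rule Cauchy_inequality)
      show "h holomorphic_on ball 0 1"
        by (rule holomorphic_on_subset[OF hol]) auto
      show "continuous_on (cball 0 1) h"
        by (rule continuous_on_subset[OF holomorphic_on_imp_continuous_on[OF hol]]) auto
      show "norm (h x) \<le> e / 2" if "norm (0 - x) = 1" for x
        using N[OF \<open>m \<ge> N\<close>, of x] that by (simp add: h_def dist_norm less_imp_le)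
    qed simp
    then have "norm ((deriv ^^ k) h 0 / fact k) \<le> e / 2"
      by (simp add: norm_divide field_simps)
    then show ?thesis using k \<open>0 < e\<close> by simp
  qed
  then show "\<exists>N. \<forall>m\<ge>N. norm (coeff (p m) k - a k) < e" by blast
qed

lemma uniform_limit_sum:
  fixes f :: "'i \<Rightarrow> 'b \<Rightarrow> 'c \<Rightarrow> 'd::real_normed_vector"
  assumes "\<And>i. i \<in> A \<Longrightarrow> uniform_limit K (f i) (g i) F"
  shows "uniform_limit K (\<lambda>n x. \<Sum>i\<in>A. f i n x) (\<lambda>x. \<Sum>i\<in>A. g i x) F"
  using assms
proof (induction A rule: infinite_finite_induct)
  case (insert i A)
  then show ?case by (simp add: uniform_limit_add)
qed (simp_all add: uniform_limit_const)

lemma uniform_limit_poly: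
  fixes q :: "nat \<Rightarrow> complex poly"
  assumes "\<And>k. (\<lambda>m. coeff (q m) k) \<longlonglongrightarrow> coeff r k"
    and deg: "\<And>m. degree (q m) \<le> n" "degree r \<le> n" and "bounded K"
  shows "uniform_limit K (\<lambda>m x. poly (q m) x) (poly r) sequentially"
proof -
  have eq: "poly s x = (\<Sum>k\<le>n. coeff s k * x ^ k)" if "degree s \<le> n" for s :: "complex poly" and x
    unfolding poly_altdef using that by (intro sum.mono_neutral_left) (auto simp: coeff_eq_0)
  have "uniform_limit K (\<lambda>m x. \<Sum>k\<le>n. coeff (q m) k * x ^ k) (\<lambda>x. \<Sum>k\<le>n. coeff r k * x ^ k) sequentially"
  proof (rule uniform_limit_sum)
    fix k
    have "bounded ((\<lambda>x. x ^ k) ` K)"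
      using \<open>bounded K\<close> unfolding bounded_iff by (auto simp: norm_power) (meson norm_ge_zero power_mono)
    moreover have "bounded ((\<lambda>_. coeff r k) ` K)"
      by (rule bounded_subset[of "{coeff r k}"]) auto
    moreover have "uniform_limit K (\<lambda>m x. coeff (q m) k) (\<lambda>x. coeff r k) sequentially"
      using assms(1)[of k] by (auto simp: uniform_limit_iff tendsto_iff elim!: eventually_mono)
    ultimately show "uniform_limit K (\<lambda>m x. coeff (q m) k * x ^ k) (\<lambda>x. coeff r k * x ^ k) sequentially"
      by (intro uniform_lim_mult uniform_limit_const)
  qed
  then show ?thesis by (simp only: eq[OF deg(1), symmetric] eq[OF deg(2), symmetric])
qed

text \<open>
  Hurwitz' theorem on the upper half-plane. The assumption on the degree of the limit keeps out the
  zero polynomial and matches the hypothesis of a non-constant limit in that theorem; zero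
  polynomials in the sequence are harmless since they occur only finitely often.
\<close>

lemma stable_poly_limit:
  assumes lim: "\<And>k. (\<lambda>m. coeff (q m) k) \<longlonglongrightarrow> coeff r k"
    and deg: "\<And>m. degree (q m) \<le> n"
    and q: "\<And>m. q m = 0 \<or> stable_poly (q m)" and r: "degree r > 0"
  shows "stable_poly r"
proof -
  have "degree r \<le> n"
  proof (rule ccontr)
    assume "\<not> degree r \<le> n"
    then have "coeff (q m) (degree r) = 0" for m
      using deg[of m] by (intro coeff_eq_0) simp
    with lim[of "degree r"] r show False by (auto simp: LIMSEQ_const_iff)
  qed
  have "coeff r (degree r) \<noteq> 0" using r by auto
  then have "eventually (\<lambda>m. coeff (q m) (degree r) \<noteq> 0) sequentially"
    using lim tendsto_imp_eventually_ne by blast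
  then obtain N where N: "\<And>m. m \<ge> N \<Longrightarrow> q m \<noteq> 0"
    unfolding eventually_sequentially by (metis coeff_0)
  let ?H = "{z. Im z > 0}"
  have "poly r z \<noteq> 0" if "Im z > 0" for z
  proof (rule Hurwitz_no_zeros[where S = ?H and g = "poly r" and ?z0.0 = z and \<F> = "\<lambda>m. poly (q (m + N))"])
    show "open ?H" by (rule open_halfspace_Im_gt)
    show "connected ?H" by (intro convex_connected convex_halfspace_Im_gt)
    show "uniform_limit K (\<lambda>m. poly (q (m + N))) (poly r) sequentially" if "compact K" for K
      by (rule uniform_limit_poly[where n = n]) (rule LIMSEQ_ignore_initial_segment lim deg
          \<open>degree r \<le> n\<close> compact_imp_bounded that)+
    show "poly (q (m + N)) z \<noteq> 0" if "z \<in> ?H" for m z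
      using that q[of "m + N"] N[of "m + N"] by (auto simp: stable_poly_def)
    show "\<not> poly r constant_on ?H"
    proof
      assume "poly r constant_on ?H"
      then obtain c where c: "\<And>z. Im z > 0 \<Longrightarrow> poly r z = c" by (auto simp: constant_on_def)
      have "r - [:c:] \<noteq> 0" using r by auto
      then have "finite {z. poly (r - [:c:]) z = 0}" by (rule poly_roots_finite)
      moreover have "?H \<subseteq> {z. poly (r - [:c:]) z = 0}" using c by auto
      moreover have "infinite ?H"
      proof -
        have "(\<lambda>n. Complex 0 (real n + 1)) ` (UNIV::nat set) \<subseteq> ?H" by auto
        moreover have "inj (\<lambda>n. Complex 0 (real n + 1))" by (auto simp: inj_def)
        ultimately show ?thesis by (meson finite_subset range_inj_infinite)
      qed
      ultimately show False using finite_subset by blast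
    qed
  qed (use that in \<open>auto intro!: holomorphic_intros\<close>)
  then show ?thesis by (simp add: stable_poly_def)
qed

section \<open>Jensen polynomials\<close>

text \<open>
  The falling factorial of \<open>n\<close> of length \<open>k\<close> divided by \<open>n ^ k\<close>. For positive \<open>n\<close>, it is visibly \<open>0\<close>
  for \<open>k > n\<close> and at most \<open>1\<close> in this form, and it tends to \<open>1\<close> as \<open>n\<close> grows.
\<close>

definition falling_ratio :: "nat \<Rightarrow> nat \<Rightarrow> real" where
  "falling_ratio n k = (\<Prod>i<k. 1 - real i / real n)"

lemma falling_ratio_bounds: "n > 0 \<Longrightarrow> 0 \<le> falling_ratio n k" "n > 0 \<Longrightarrow> falling_ratio n k \<le> 1"
proof -
  have "0 \<le> falling_ratio n k \<and> falling_ratio n k \<le> 1" if "n > 0"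
  proof (cases "k \<le> n")
    case True
    then show ?thesis unfolding falling_ratio_def by (intro conjI prod_nonneg prod_le_1) auto
  next
    case False
    then have "falling_ratio n k = 0" unfolding falling_ratio_def using that
      by (auto intro!: bexI[of _ n])
    then show ?thesis by simp
  qed
  then show "n > 0 \<Longrightarrow> 0 \<le> falling_ratio n k" "n > 0 \<Longrightarrow> falling_ratio n k \<le> 1" by auto
qed

lemma falling_ratio_fact:
  assumes "k \<le> n" "n > 0"
  shows "falling_ratio n k = fact n / (fact (n - k) * real n ^ k)"
  using assms
proof (induction k)
  case (Suc k)
  then have "fact (n - k) = real (n - k) * fact (n - Suc k)"
    by (metis Suc_diff_Suc Suc_le_lessD fact_Suc of_nat_fact of_nat_mult)
  with Suc show ?case by (simp add: falling_ratio_def field_simps of_nat_diff)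
qed (simp add: falling_ratio_def)

lemma falling_ratio_tendsto: "(\<lambda>n. falling_ratio n k) \<longlonglongrightarrow> 1"
proof -
  have "(\<lambda>n. \<Prod>i<k. 1 - real i / real n) \<longlonglongrightarrow> (\<Prod>i<k. 1 - 0)"
    by (intro tendsto_prod tendsto_diff tendsto_const lim_const_over_n)
  then show ?thesis by (simp add: falling_ratio_def)
qed

text \<open>
  For \<open>f x = (\<Sum>k. u k * x ^ k)\<close> this is the \<open>n\<close>-th Jensen polynomial of \<open>f\<close> evaluated at \<open>x / n\<close>.
\<close>

definition jensen_poly :: "(nat \<Rightarrow> real) \<Rightarrow> nat \<Rightarrow> complex poly" where
  "jensen_poly u n = (\<Sum>k\<le>n. monom (of_real (u k * falling_ratio n k)) k)"

lemma poly_jensen_poly: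
  "poly (jensen_poly u n) x = (\<Sum>k\<le>n. of_real (u k * falling_ratio n k) * x ^ k)"
  by (simp add: jensen_poly_def poly_sum poly_monom)

lemma jensen_poly_tendsto:
  assumes u: "\<And>k. 0 \<le> u k" and x: "0 \<le> x" and sums: "(\<lambda>k. u k * x ^ k) sums s"
  shows "(\<lambda>n. poly (jensen_poly u n) (of_real x)) \<longlonglongrightarrow> of_real s"
proof -
  define a where "a k n = (if k \<le> n then u k * falling_ratio n k * x ^ k else 0)" for k n
  have "eventually (\<lambda>n. summable (\<lambda>k. norm (a k n))) sequentially \<and>
     summable (\<lambda>k. norm (u k * x ^ k)) \<and> (\<lambda>n. suminf (\<lambda>k. a k n)) \<longlonglongrightarrow> suminf (\<lambda>k. u k * x ^ k)"
  proof (rule tannerys_theorem)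
    fix k
    have "(\<lambda>n. u k * falling_ratio n k * x ^ k) \<longlonglongrightarrow> u k * 1 * x ^ k"
      by (intro tendsto_intros falling_ratio_tendsto)
    moreover have "eventually (\<lambda>n. a k n = u k * falling_ratio n k * x ^ k) sequentially"
      using eventually_ge_at_top[of k] by eventually_elim (simp add: a_def)
    ultimately show "(\<lambda>n. a k n) \<longlonglongrightarrow> u k * x ^ k"
      by (simp add: tendsto_cong)
  next
    have "norm (a k n) \<le> u k * x ^ k" if "n > 0" for k n
    proof -
      have "u k * falling_ratio n k * x ^ k \<le> u k * 1 * x ^ k"
        using falling_ratio_bounds[OF that] u x by (intro mult_mono mult_nonneg_nonneg) auto
      then show ?thesis using falling_ratio_bounds[OF that] u x by (simp add: a_def)
    qed
    then show "eventually (\<lambda>(k, n). norm (a k n) \<le> u k * x ^ k) (sequentially \<times>\<^sub>F sequentially)"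
      unfolding eventually_prod_sequentially by (intro exI[of _ 1]) auto
    show "summable (\<lambda>k. u k * x ^ k)" using sums sums_summable by blast
  qed simp
  then have "(\<lambda>n. suminf (\<lambda>k. a k n)) \<longlonglongrightarrow> s" using sums sums_unique by metis
  moreover have "suminf (\<lambda>k. a k n) = (\<Sum>k\<le>n. u k * falling_ratio n k * x ^ k)" for n
    by (subst suminf_finite[of "{..n}"]) (auto simp: a_def)
  ultimately have "(\<lambda>n. of_real (\<Sum>k\<le>n. u k * falling_ratio n k * x ^ k) :: complex) \<longlonglongrightarrow> of_real s"
    by (intro tendsto_of_real) simp
  then show ?thesis by (simp add: poly_jensen_poly)
qed

text \<open>
  Up to the substitution \<open>z \<mapsto> - n / z\<close>, which maps the upper half-plane to itself, and a power of
  \<open>z\<close>, the Jensen polynomial is the limit of \<open>p m(-d/dx) x ^ n\<close> for stable \<open>p m\<close> approximating \<open>f\<close>.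
  So it has no zeros in the upper half-plane, none in the lower one because its coefficients are
  real, and none on the positive axis because they are non-negative.
\<close>

lemma jensen_poly_root_nonpos_real:
  assumes f: "t_stable f" "\<And>x. (\<lambda>k. of_real (u k) * x ^ k) sums f x"
    and u: "\<And>k. 0 \<le> u k" "u k0 > 0" and n: "n > k0" and w: "poly (jensen_poly u n) w = 0"
  shows "w \<in> \<real>\<^sub>\<le>\<^sub>0"
proof -
  obtain p where p: "\<And>m. stable_poly (p m)"
    and lim: "\<And>K. compact K \<Longrightarrow> uniform_limit K (\<lambda>m x. poly (p m) x) f sequentially"
    using f(1) unfolding t_stable_def by blast
  \<comment> \<open>The limit of \<open>p m(-d/dx) x ^ n\<close>: the reversed Jensen polynomial with alternating signs.\<close>
  define r :: "complex poly" where
    "r = (\<Sum>k\<le>n. monom ((-1) ^ k * of_real (u k) * (fact n / fact (n - k))) (n - k))"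
  have coeff_monom_sum: "coeff (\<Sum>k\<le>n. monom (g k) (n - k)) j = (if j \<le> n then g (n - j) else 0)"
    for g :: "nat \<Rightarrow> complex" and j
  proof -
    have "coeff (\<Sum>k\<le>n. monom (g k) (n - k)) j = (\<Sum>k\<le>n. if k = n - j \<and> j \<le> n then g k else 0)"
      by (simp add: coeff_sum) (intro sum.cong, auto)
    also have "\<dots> = (if j \<le> n then g (n - j) else 0)" by (cases "j \<le> n") auto
    finally show ?thesis .
  qed
  have "stable_poly r"
  proof (rule stable_poly_limit[where q = "\<lambda>m. poly_neg_deriv (p m) (monom 1 n)" and n = n])
    fix k
    have "(\<lambda>m. coeff (p m) j) \<longlonglongrightarrow> of_real (u j)" for j
      by (rule tendsto_coeff_of_uniform_limit[OF lim f(2)]) simp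
    then have "(\<lambda>m. (-1) ^ j * coeff (p m) j * (fact n / fact (n - j))) \<longlonglongrightarrow>
        (-1) ^ j * of_real (u j) * (fact n / fact (n - j))" for j
      by (intro tendsto_mult tendsto_const)
    then show "(\<lambda>m. coeff (poly_neg_deriv (p m) (monom 1 n)) k) \<longlonglongrightarrow> coeff r k"
      unfolding poly_neg_deriv_monom r_def coeff_monom_sum by (cases "k \<le> n") (simp_all del: times_divide_eq_right)
  next
    fix m show "degree (poly_neg_deriv (p m) (monom 1 n)) \<le> n"
      unfolding poly_neg_deriv_monom by (intro degree_le) (auto simp: coeff_monom_sum)
    have "stable_poly (monom 1 n)"
      by (auto simp: stable_poly_def poly_monom)
    then show "poly_neg_deriv (p m) (monom 1 n) = 0 \<or> stable_poly (poly_neg_deriv (p m) (monom 1 n))"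
      by (intro poly_neg_deriv_stable p)
  next
    have "coeff r (n - k0) \<noteq> 0" unfolding r_def coeff_monom_sum using n u by simp
    \<comment> \<open>The limit must not be constant; this is where \<open>n > k0\<close> matters.\<close>
    then have "n - k0 \<le> degree r" by (rule le_degree)
    with n show "degree r > 0" by simp
  qed
  have n0: "n > 0" using n by simp
  have reverse: "poly r (- of_nat n / z) = (- of_nat n / z) ^ n * poly (jensen_poly u n) z" if "z \<noteq> 0" for z
  proof -
    define y where "y = - of_nat n / z"
    have y: "y \<noteq> 0" "z = - of_nat n / y" using n that by (auto simp: y_def)
    show ?thesis
      unfolding y_def[symmetric] r_def poly_sum poly_monom poly_jensen_poly sum_distrib_left
    proof (intro sum.cong refl)
      fix k assume "k \<in> {..n}"
      then have k: "k \<le> n" by simp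
      have "y ^ n = y ^ (n - k) * y ^ k" using k by (simp flip: power_add)
      moreover have "y ^ k * z ^ k = (- of_nat n) ^ k" using y by (simp flip: power_mult_distrib)
      ultimately have "y ^ n * z ^ k = y ^ (n - k) * ((-1) ^ k * of_nat n ^ k)"
        by (simp add: power_minus[of "of_nat n :: complex"] mult.assoc)
      moreover have "(-1) ^ k * of_real (u k) * (fact n / fact (n - k)) =
          of_real (u k * falling_ratio n k) * ((-1) ^ k * of_nat n ^ k :: complex)"
        unfolding falling_ratio_fact[OF k n0] using n0 by (simp add: field_simps)
      ultimately show "(-1) ^ k * of_real (u k) * (fact n / fact (n - k)) * y ^ (n - k) =
        y ^ n * (of_real (u k * falling_ratio n k) * z ^ k)"
        by (simp add: algebra_simps)
    qed
  qed
  have upper: "poly (jensen_poly u n) z \<noteq> 0" if "Im z > 0" for z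
  proof
    assume "poly (jensen_poly u n) z = 0"
    moreover have "z \<noteq> 0" using that by auto
    ultimately have "poly r (- of_nat n / z) = 0" using reverse by simp
    moreover have "Im (- of_nat n / z) > 0"
      using that n0 \<open>z \<noteq> 0\<close> by (simp add: Im_divide_of_nat Im_divide complex_eq_iff sum_power2_gt_zero_iff)
    ultimately show False using \<open>stable_poly r\<close> by (auto simp: stable_poly_def)
  qed
  have "poly (jensen_poly u n) (cnj w) = cnj (poly (jensen_poly u n) w)"
    by (simp add: poly_jensen_poly)
  with w have "poly (jensen_poly u n) (cnj w) = 0" by simp
  with upper have "\<not> Im (cnj w) > 0" by blast
  moreover from upper w have "\<not> Im w > 0" by blast
  ultimately have "Im w = 0" by simp
  then have w': "w = of_real (Re w)" by (simp add: complex_eq_iff)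
  have "Re w \<le> 0"
  proof (rule ccontr)
    assume "\<not> Re w \<le> 0"
    then have pos: "Re w > 0" by simp
    have "poly (jensen_poly u n) w = of_real (\<Sum>k\<le>n. u k * falling_ratio n k * Re w ^ k)"
      by (subst w') (simp add: poly_jensen_poly)
    moreover have "(\<Sum>k\<le>n. u k * falling_ratio n k * Re w ^ k) > 0"
    proof (rule sum_pos2[of _ k0])
      show "0 < u k0 * falling_ratio n k0 * Re w ^ k0"
        using u n n0 pos by (simp add: falling_ratio_fact)
    qed (use n n0 u pos falling_ratio_bounds in auto)
    ultimately show False using w by (metis of_real_eq_0_iff less_irrefl)
  qed
  with w' show ?thesis by (metis nonpos_Reals_of_real_iff)
qed

section \<open>Limits of products of Bernoulli generating functions\<close>

text \<open>
  A zero \<open>a \<le> 0\<close> contributes \<open>x - a = (1 - a) (1 + p (x - 1))\<close> with \<open>p = 1 / (1 - a)\<close>. The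
  parameters are put in decreasing order and padded with zeros.
\<close>

lemma bernoulli_factorization:
  fixes P :: "complex poly"
  assumes P: "P \<noteq> 0" and roots: "\<And>z. poly P z = 0 \<Longrightarrow> z \<in> \<real>\<^sub>\<le>\<^sub>0"
  obtains p :: "nat \<Rightarrow> real" where "decseq p" "\<And>i. 0 \<le> p i" "\<And>i. p i \<le> 1"
    "\<And>i. i \<ge> degree P \<Longrightarrow> p i = 0"
    "\<And>x. poly P x = poly P 1 * (\<Prod>i<degree P. 1 + of_real (p i) * (x - 1))"
proof -
  define s where "s a = 1 / (1 - Re a)" for a :: complex
  define Q where "Q = image_mset s (proots P)"
  define L where "L = rev (sorted_list_of_multiset Q)"
  define p where "p i = (if i < length L then L ! i else 0)" for i
  have mL: "mset L = Q" by (simp add: L_def)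
  have len: "length L = degree P"
    using arg_cong[OF mL, of size] by (simp add: Q_def size_proots_complex)
  have root: "\<exists>t\<le>0. a = of_real t" if "a \<in># proots P" for a
    using that roots[of a] P by (auto elim: nonpos_Reals_cases)
  have L01: "0 \<le> y \<and> y \<le> 1" if "y \<in> set L" for y
  proof -
    have "y \<in># Q" using that mL by (metis set_mset_mset)
    then obtain a where "a \<in># proots P" "y = s a" unfolding Q_def by auto
    with root[of a] show ?thesis by (auto simp: s_def)
  qed
  have p01: "0 \<le> p i \<and> p i \<le> 1" for i
    using L01 by (auto simp: p_def)
  have "sorted (rev L)" by (simp add: L_def)
  then have dec: "L ! i \<ge> L ! j" if "i \<le> j" "j < length L" for i j
    using that by (simp add: sorted_rev_nth_mono)
  have "decseq p"
    unfolding decseq_def using dec p01 by (auto simp: p_def intro: L01[THEN conjunct1])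
  have factor: "poly P x = lead_coeff P * (\<Prod>a\<in>#proots P. x - a)" for x
    by (subst complex_poly_decompose_multiset[of P, symmetric])
      (simp add: poly_prod_mset image_mset.compositionality o_def del: complex_poly_decompose_multiset)
  have shift: "(\<Prod>a\<in>#proots P. x - a) = (\<Prod>a\<in>#proots P. 1 - a) * (\<Prod>a\<in>#proots P. 1 + of_real (s a) * (x - 1))" for x
    unfolding prod_mset.distrib[symmetric]
  proof (intro arg_cong[of _ _ prod_mset] image_mset_cong)
    fix a assume "a \<in># proots P"
    with root obtain t where t: "t \<le> 0" "a = of_real t" by blast
    then have "(1 - t) * s a = 1" by (simp add: s_def)
    then have "(1 - a) * of_real (s a) = 1"
      unfolding t(2) by (metis of_real_1 of_real_diff of_real_mult)
    then show "x - a = (1 - a) * (1 + of_real (s a) * (x - 1))"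
      by (simp add: distrib_left mult.assoc[symmetric])
  qed
  have "(\<Prod>a\<in>#proots P. 1 + of_real (s a) * (x - 1)) = (\<Prod>i<degree P. 1 + of_real (p i) * (x - 1))" for x :: complex
  proof -
    have "(\<Prod>a\<in>#proots P. 1 + of_real (s a) * (x - 1)) = (\<Prod>y\<in>#mset L. 1 + of_real y * (x - 1))"
      unfolding mL Q_def by (simp add: image_mset.compositionality o_def)
    also have "\<dots> = (\<Prod>y\<leftarrow>L. 1 + of_real y * (x - 1))"
      by (simp flip: prod_mset_prod_list)
    also have "\<dots> = (\<Prod>i<degree P. 1 + of_real (p i) * (x - 1))"
      by (subst prod.list_conv_set_nth) (auto simp: atLeast0LessThan len p_def)
    finally show ?thesis .
  qed
  then have "poly P x = poly P 1 * (\<Prod>i<degree P. 1 + of_real (p i) * (x - 1))" for x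
    using factor[of x] factor[of 1] shift[of x] by simp
  moreover have "p i = 0" if "i \<ge> degree P" for i using that len by (simp add: p_def)
  ultimately show ?thesis using that \<open>decseq p\<close> p01 by blast
qed

text \<open>
  With \<open>y = p (x - 1) \<ge> x - 1\<close>, the inequalities \<open>y / (1 + y) \<le> ln (1 + y) \<le> y\<close> bound the error by
  \<open>y\<^sup>2 / (1 + y)\<close>. It is quadratic in \<open>p\<close>, uniformly for \<open>x\<close> bounded away from \<open>0\<close>.
\<close>

lemma ln_error_bound:
  fixes p x :: real
  assumes "0 < x" "x \<le> 1" "0 \<le> p" "p \<le> 1"
  shows "\<bar>ln (1 + p * (x - 1)) - p * (x - 1)\<bar> \<le> p\<^sup>2 / x"
proof -
  define y where "y = p * (x - 1)"
  have "p * (1 - x) \<le> 1 * (1 - x)" using assms by (intro mult_right_mono) auto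
  then have y: "x \<le> 1 + y" by (simp add: y_def algebra_simps)
  have "ln (1 + y) \<le> y" using ln_le_minus_one[of "1 + y"] y assms by simp
  moreover have "y - y\<^sup>2 / (1 + y) \<le> ln (1 + y)"
  proof -
    have "ln (inverse (1 + y)) \<le> inverse (1 + y) - 1"
      using y assms by (intro ln_le_minus_one) auto
    moreover have "y - y\<^sup>2 / (1 + y) = 1 - inverse (1 + y)"
      using y assms by (simp add: field_simps power2_eq_square)
    ultimately show ?thesis using y assms by (simp add: ln_inverse)
  qed
  moreover have "y\<^sup>2 / (1 + y) \<le> p\<^sup>2 / x"
  proof (rule frac_le)
    have "(x - 1)\<^sup>2 \<le> 1" using assms by (simp add: abs_square_le_1)
    then show "y\<^sup>2 \<le> p\<^sup>2" unfolding y_def power_mult_distrib by (simp add: mult_left_le)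
  qed (use y assms in auto)
  ultimately show ?thesis by (simp add: y_def[symmetric] abs_le_iff)
qed

lemma prod_eq_exp_sum_ln:
  fixes p :: "nat \<Rightarrow> real"
  assumes "0 < x" "x \<le> 1" "\<And>i. 0 \<le> p i" "\<And>i. p i \<le> 1"
  shows "(\<Prod>i<n. 1 + p i * (x - 1)) =
    exp ((\<Sum>i<n. ln (1 + p i * (x - 1)) - p i * (x - 1)) + (\<Sum>i<n. p i) * (x - 1))"
proof -
  have pos: "0 < 1 + p i * (x - 1)" for i
  proof -
    have "p i * (1 - x) \<le> 1 * (1 - x)" using assms by (intro mult_right_mono) auto
    then show ?thesis using assms(1) by (simp add: algebra_simps)
  qed
  have "(\<Prod>i<n. 1 + p i * (x - 1)) = exp (\<Sum>i<n. ln (1 + p i * (x - 1)))"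
    by (subst exp_sum) (auto intro!: prod.cong simp: pos)
  then show ?thesis by (simp add: sum_subtractf sum_distrib_right)
qed

text \<open>
  This is \<open>1 - p / 2 \<le> exp (- p / 2)\<close> for each factor. It turns a positive lower bound for a product
  of Bernoulli generating functions at \<open>1/2\<close> into an upper bound for the sum of the parameters.
\<close>

lemma exp_half_sum_le_inverse_prod:
  fixes p :: "nat \<Rightarrow> real"
  assumes "\<And>i. p i \<le> 1"
  shows "exp ((\<Sum>i<n. p i) / 2) \<le> inverse (\<Prod>i<n. 1 + p i * (1/2 - 1))"
proof -
  let ?P = "\<Prod>i<n. 1 + p i * (1/2 - 1)"
  have "?P \<le> (\<Prod>i<n. exp (- p i / 2))"
  proof (rule prod_mono)
    fix i
    show "0 \<le> 1 + p i * (1/2 - 1) \<and> 1 + p i * (1/2 - 1) \<le> exp (- p i / 2)"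
      using assms[of i] exp_ge_add_one_self[of "- p i / 2"] by (simp add: algebra_simps)
  qed
  also have "\<dots> = exp (- ((\<Sum>i<n. p i) / 2))"
    by (simp add: exp_sum[symmetric] sum_negf sum_divide_distrib)
  finally have "?P \<le> exp (- ((\<Sum>i<n. p i) / 2))" .
  moreover have "0 < ?P"
  proof (rule prod_pos)
    show "0 < 1 + p i * (1/2 - 1)" for i
      using assms[of i] by (simp add: algebra_simps)
  qed
  ultimately have "inverse (exp (- ((\<Sum>i<n. p i) / 2))) \<le> inverse ?P"
    by (intro le_imp_inverse_le)
  then show ?thesis by (simp add: exp_minus)
qed

text \<open>
  Taking logarithms, \<open>ln (1 + p (x - 1)) = p (x - 1) + h\<close> with \<open>h\<close> of order \<open>p\<^sup>2\<close>. The sums of the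
  \<open>h\<close> converge by dominated convergence, as the parameters decrease and have bounded sum. The sums
  of the parameters converge along a subsequence to a number \<open>m\<close> that may exceed the sum of the
  limiting parameters by Fatou's inequality; the excess is the Poisson parameter.
\<close>

lemma bernoulli_products_limit:
  fixes p :: "nat \<Rightarrow> nat \<Rightarrow> real" and N :: "nat \<Rightarrow> nat" and \<phi> :: "real \<Rightarrow> real"
  assumes dec: "\<And>n. decseq (p n)" and p0: "\<And>n i. 0 \<le> p n i" and p1: "\<And>n i. p n i \<le> 1"
    and fin: "\<And>n i. i \<ge> N n \<Longrightarrow> p n i = 0"
    and lim: "\<And>x. 0 < x \<Longrightarrow> x \<le> 1 \<Longrightarrow> (\<lambda>n. \<Prod>i<N n. 1 + p n i * (x - 1)) \<longlonglongrightarrow> \<phi> x"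
    and pos: "\<phi> (1/2) > 0"
  obtains q :: "nat \<Rightarrow> real" and r where "\<And>i. 0 \<le> q i" "\<And>i. q i \<le> 1" "summable q" "0 \<le> r"
    "\<And>x. 0 < x \<Longrightarrow> x \<le> 1 \<Longrightarrow> (\<lambda>n. (\<Prod>i<n. 1 + q i * (x - 1)) * exp (r * (x - 1))) \<longlonglongrightarrow> \<phi> x"
proof -
  define S where "S n = (\<Sum>i<N n. p n i)" for n
  have p_sums: "p n sums S n" for n
    unfolding S_def by (rule sums_finite) (use fin in auto)
  have S0: "0 \<le> S n" for n unfolding S_def by (intro sum_nonneg p0)
  have partial: "(\<Sum>i<j. p n i) \<le> S n" for n j
    using sum_le_suminf[OF sums_summable[OF p_sums], of "{..<j}" n] p0 sums_unique[OF p_sums, of n] by auto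
  \<comment> \<open>The sums of the parameters are bounded because the products at \<open>1/2\<close> have a positive limit.\<close>
  obtain M where M: "\<And>n. S n \<le> M" and M1: "1 \<le> M"
  proof -
    let ?P = "\<lambda>n. \<Prod>i<N n. 1 + p n i * (1/2 - 1)"
    have "(\<lambda>n. inverse (?P n)) \<longlonglongrightarrow> inverse (\<phi> (1/2))"
      using lim[of "1/2"] pos by (intro tendsto_inverse) auto
    then have "Bseq (\<lambda>n. inverse (?P n))" by (intro convergent_imp_Bseq convergentI)
    then obtain K where K: "\<And>n. norm (inverse (?P n)) \<le> K" by (auto simp: Bseq_def)
    have "S n \<le> max 1 (2 * K)" for n
    proof -
      have "1 + S n / 2 \<le> exp (S n / 2)" by (rule exp_ge_add_one_self)
      also have "\<dots> \<le> inverse (?P n)"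
        unfolding S_def by (rule exp_half_sum_le_inverse_prod[OF p1])
      also have "\<dots> \<le> K"
        using K[of n] unfolding real_norm_def by linarith
      finally show ?thesis by linarith
    qed
    then show ?thesis by (intro that[of "max 1 (2 * K)"]) auto
  qed
  \<comment> \<open>The first \<open>i + 1\<close> parameters are all at least \<open>p n i\<close>.\<close>
  have p_le: "p n i \<le> M / real (Suc i)" for n i
  proof -
    have "real (Suc i) * p n i = (\<Sum>j<Suc i. p n i)" by simp
    also have "\<dots> \<le> (\<Sum>j<Suc i. p n j)"
      using dec[of n] by (intro sum_mono) (auto simp: decseq_def)
    also have "\<dots> \<le> M" using partial[of n "Suc i"] M[of n] by linarith
    finally show ?thesis by (simp add: field_simps)
  qed
  \<comment> \<open>One diagonal subsequence serves the sums (index \<open>0\<close>) and all the parameters (positive indices).\<close>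
  obtain k where k: "strict_mono k"
    and conv: "\<And>j. \<exists>l. (\<lambda>n. case j of 0 \<Rightarrow> S (k n) | Suc i \<Rightarrow> p (k n) i) \<longlonglongrightarrow> l"
  proof (rule function_convergent_subsequence[of UNIV "\<lambda>n j. case j of 0 \<Rightarrow> S n | Suc i \<Rightarrow> p n i" M])
    show "norm (case j of 0 \<Rightarrow> S n | Suc i \<Rightarrow> p n i) \<le> M" for n j
      using M[of n] M1 S0[of n] p0[of n] p1[of n] by (auto split: nat.split intro: order_trans)
  qed auto
  obtain m where m: "(\<lambda>n. S (k n)) \<longlonglongrightarrow> m" using conv[of 0] by auto
  define q where "q i = lim (\<lambda>n. p (k n) i)" for i
  have q: "(\<lambda>n. p (k n) i) \<longlonglongrightarrow> q i" for i
    using conv[of "Suc i"] by (auto simp: q_def limI)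
  have q0: "0 \<le> q i" for i by (rule LIMSEQ_le_const[OF q]) (use p0 in auto)
  have q1: "q i \<le> 1" for i by (rule LIMSEQ_le_const2[OF q]) (use p1 in auto)
  have q_partial: "(\<Sum>i<j. q i) \<le> m" for j
    by (rule LIMSEQ_le[OF tendsto_sum[OF q] m]) (use partial in auto)
  have q_sum: "summable q"
    by (rule summableI_nonneg_bounded[OF q0 q_partial])
  have q_le: "suminf q \<le> m" by (rule suminf_le_const[OF q_sum q_partial])
  define h where "h x y = ln (1 + y * (x - 1)) - y * (x - 1)" for x y :: real
  have main: "(\<lambda>n. (\<Prod>i<n. 1 + q i * (x - 1)) * exp ((m - suminf q) * (x - 1))) \<longlonglongrightarrow> \<phi> x"
    if x: "0 < x" "x \<le> 1" for x
  proof -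
    have "eventually (\<lambda>n. summable (\<lambda>i. norm (h x (p (k n) i)))) sequentially \<and>
       summable (\<lambda>i. norm (h x (q i))) \<and> (\<lambda>n. suminf (\<lambda>i. h x (p (k n) i))) \<longlonglongrightarrow> suminf (\<lambda>i. h x (q i))"
    proof (rule tannerys_theorem)
      fix i
      have "q i * (1 - x) \<le> 1 * (1 - x)" using x q1 by (intro mult_right_mono) auto
      then have "1 + q i * (x - 1) \<noteq> 0" using x(1) by (simp add: algebra_simps)
      then show "(\<lambda>n. h x (p (k n) i)) \<longlonglongrightarrow> h x (q i)"
        unfolding h_def by (intro tendsto_intros q)
    next
      have "norm (h x (p (k n) i)) \<le> (M / real (Suc i))\<^sup>2 / x" for i n
      proof -
        have "norm (h x (p (k n) i)) \<le> (p (k n) i)\<^sup>2 / x"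
          unfolding h_def real_norm_def by (rule ln_error_bound[OF x p0 p1])
        also have "\<dots> \<le> (M / real (Suc i))\<^sup>2 / x"
          using x p_le p0 by (intro divide_right_mono power_mono) auto
        finally show ?thesis .
      qed
      then show "eventually (\<lambda>(i, n). norm (h x (p (k n) i)) \<le> (M / real (Suc i))\<^sup>2 / x) (sequentially \<times>\<^sub>F sequentially)"
        by (intro always_eventually) auto
      have "summable (\<lambda>i. M\<^sup>2 / x * inverse (real (Suc i) ^ 2))"
        by (intro summable_mult) (subst summable_Suc_iff, rule inverse_power_summable, simp)
      then show "summable (\<lambda>i. (M / real (Suc i))\<^sup>2 / x)"
        by (simp add: power_divide field_simps)
    qed simp
    then have hs: "summable (\<lambda>i. h x (q i))"
      and hl: "(\<lambda>n. suminf (\<lambda>i. h x (p (k n) i))) \<longlonglongrightarrow> suminf (\<lambda>i. h x (q i))"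
      by (auto dest: summable_rabs_cancel)
    have "(\<Prod>i<N n. 1 + p n i * (x - 1)) = exp (suminf (\<lambda>i. h x (p n i)) + S n * (x - 1))" for n
      by (subst suminf_finite[of "{..<N n}"])
         (auto simp: fin h_def prod_eq_exp_sum_ln[OF x p0 p1] S_def)
    then have "(\<lambda>n. \<Prod>i<N (k n). 1 + p (k n) i * (x - 1)) \<longlonglongrightarrow> exp (suminf (\<lambda>i. h x (q i)) + m * (x - 1))"
      by (simp only:) (intro tendsto_intros hl m)
    moreover have "(\<lambda>n. \<Prod>i<N (k n). 1 + p (k n) i * (x - 1)) \<longlonglongrightarrow> \<phi> x"
      using LIMSEQ_subseq_LIMSEQ[OF lim[OF x] k] by (simp add: o_def)
    ultimately have phi: "\<phi> x = exp (suminf (\<lambda>i. h x (q i)) + m * (x - 1))"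
      using LIMSEQ_unique by blast
    have "(\<lambda>n. exp ((\<Sum>i<n. h x (q i)) + (\<Sum>i<n. q i) * (x - 1)) * exp ((m - suminf q) * (x - 1)))
       \<longlonglongrightarrow> exp (suminf (\<lambda>i. h x (q i)) + suminf q * (x - 1)) * exp ((m - suminf q) * (x - 1))"
      by (intro tendsto_intros summable_LIMSEQ hs q_sum)
    also have "exp (suminf (\<lambda>i. h x (q i)) + suminf q * (x - 1)) * exp ((m - suminf q) * (x - 1)) = \<phi> x"
      unfolding phi mult_exp_exp by (simp add: algebra_simps)
    finally show ?thesis by (simp only: prod_eq_exp_sum_ln[OF x q0 q1] h_def)
  qed
  show ?thesis
    by (rule that[of q "m - suminf q"]) (use q0 q1 q_sum q_le main in auto)
qed

section \<open>Infinite Bernoulli-Poisson products as entire functions\<close>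

text \<open>
  With \<open>w = g x / n\<close>, telescoping bounds the distance of \<open>(1 + w) ^ n\<close> and \<open>exp w ^ n\<close> by a constant
  times \<open>n\<close> times the distance of \<open>1 + w\<close> and \<open>exp w\<close>, which is of order \<open>1 / n\<^sup>2\<close>.
\<close>

lemma exp_power_uniform_limit:
  fixes g :: "'a::topological_space \<Rightarrow> complex"
  assumes "bounded (g ` K)"
  shows "uniform_limit K (\<lambda>n x. (1 + g x / of_nat n) ^ n) (\<lambda>x. exp (g x)) sequentially"
proof -
  obtain R where R: "R > 0" "\<And>x. x \<in> K \<Longrightarrow> norm (g x) \<le> R"
    using assms unfolding bounded_pos by auto
  have bound: "norm ((1 + g x / of_nat n) ^ n - exp (g x)) \<le> exp (R + 1) * R\<^sup>2 / real n"
    if x: "x \<in> K" and n: "real n \<ge> R" for x n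
  proof -
    have n0: "n > 0" using n R by (cases n) auto
    define w where "w = g x / of_nat n"
    \<comment> \<open>Dividing by \<open>c\<close> moves both numbers into the unit disc, at the price of the factor \<open>c ^ n = exp R\<close>.\<close>
    define c where "c = exp (R / real n)"
    have w: "norm w \<le> R / real n" "norm w \<le> 1"
      using R(2)[OF x] n n0 by (auto simp: w_def norm_divide field_simps)
    have c1: "c \<ge> 1" using R n0 by (simp add: c_def)
    have cn: "c ^ n = exp R" using n0 by (simp add: c_def exp_of_nat_mult[symmetric])
    have e: "exp (g x) = exp w ^ n" using n0 by (simp add: w_def exp_of_nat_mult[symmetric])
    have "norm (1 + w) \<le> 1 + norm w" by (metis norm_one norm_triangle_ineq)
    also have "\<dots> \<le> 1 + R / real n" using w by simp
    also have "\<dots> \<le> c" unfolding c_def by (rule exp_ge_add_one_self)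
    finally have 1: "norm (1 + w) \<le> c" .
    have "norm (exp w) \<le> exp (norm w)" by (rule norm_exp)
    then have 2: "norm (exp w) \<le> c" unfolding c_def using w(1) by (meson exp_le_cancel_iff order_trans)
    have "norm ((1 + w) ^ n - exp w ^ n) = norm (of_real (c ^ n) * (((1 + w) / of_real c) ^ n - (exp w / of_real c) ^ n))"
      using c1 by (simp add: power_divide algebra_simps)
    also have "\<dots> = exp R * norm (((1 + w) / of_real c) ^ n - (exp w / of_real c) ^ n)"
      unfolding norm_mult cn by simp
    also have "\<dots> \<le> exp R * (real n * norm ((1 + w) / of_real c - exp w / of_real c))"
      using 1 2 c1 by (intro mult_left_mono norm_power_diff) (auto simp: norm_divide)
    also have "norm ((1 + w) / of_real c - exp w / of_real c) = norm (exp w - (1 + w)) / c"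
      using c1 by (simp add: diff_divide_distrib[symmetric] norm_divide norm_minus_commute)
    also have "norm (exp w - (1 + w)) / c \<le> norm (exp w - (1 + w)) / 1"
      using c1 by (intro divide_left_mono) auto
    also have "norm (exp w - (1 + w)) \<le> exp \<bar>Re w\<bar> * norm w ^ Suc 1 / fact 1"
      using Taylor_exp[of w 1] by simp
    also have "\<dots> \<le> exp 1 * (R / real n)\<^sup>2"
      using w abs_Re_le_cmod[of w] by (auto intro!: mult_mono power_mono simp flip: power2_eq_square)
    also have "exp R * (real n * (exp 1 * (R / real n)\<^sup>2 / 1)) = exp (R + 1) * R\<^sup>2 / real n"
      using n0 by (simp add: exp_add power2_eq_square field_simps)
    finally show ?thesis by (simp add: e w_def mult_left_mono)
  qed
  show ?thesis
  proof (rule uniform_limitI)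
    fix e :: real assume "e > 0"
    have "(\<lambda>n. exp (R + 1) * R\<^sup>2 / real n) \<longlonglongrightarrow> 0" by (rule lim_const_over_n)
    then have "eventually (\<lambda>n. exp (R + 1) * R\<^sup>2 / real n < e) sequentially"
      using \<open>e > 0\<close> by (rule order_tendstoD)
    moreover have "eventually (\<lambda>n. real n \<ge> R) sequentially"
      by (rule eventually_sequentiallyI[of "nat \<lceil>R\<rceil>"]) linarith
    ultimately show "\<forall>\<^sub>F n in sequentially. \<forall>x\<in>K. dist ((1 + g x / of_nat n) ^ n) (exp (g x)) < e"
      by eventually_elim (use bound in \<open>force simp: dist_norm\<close>)
  qed
qed

text \<open>
  The function \<open>f\<close> is the infinite product times the exponential; the approximating stable
  polynomials combine the partial products with \<open>(1 + r (x - 1) / n) ^ n\<close>.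
\<close>

lemma t_stable_bernoulli_poisson:
  assumes p: "summable p" "\<And>i. 0 \<le> p i" and r: "0 \<le> r"
  obtains f where "t_stable f" "f holomorphic_on UNIV"
    "\<And>x. (\<lambda>n. (\<Prod>i<n. 1 + of_real (p i) * (x - 1)) * exp (of_real r * (x - 1))) \<longlonglongrightarrow> f x"
proof -
  define P where "P n x = (\<Prod>i<n. 1 + of_real (p i) * (x - 1))" for n and x :: complex
  define F where "F x = lim (\<lambda>n. P n x)" for x
  have FK: "uniform_limit K P F sequentially" if K: "compact K" for K
  proof -
    obtain R where R: "\<And>x. x \<in> K \<Longrightarrow> norm x \<le> R"
      using compact_imp_bounded[OF K] unfolding bounded_iff by blast
    have "uniformly_convergent_on K (\<lambda>N x. \<Sum>n<N. norm (of_real (p n) * (x - 1)))"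
    proof (rule Weierstrass_m_test')
      show "norm (norm (of_real (p n) * (x - 1))) \<le> p n * (R + 1)" if "x \<in> K" for n x
        using R[OF that] norm_triangle_ineq4[of x 1] p(2)[of n]
        by (auto simp: norm_mult intro!: mult_left_mono)
      show "summable (\<lambda>n. p n * (R + 1))" using p by (intro summable_mult2)
    qed
    then have "uniformly_convergent_on K (\<lambda>N x. \<Prod>n<N. 1 + of_real (p n) * (x - 1))"
      by (intro uniformly_convergent_on_prod K continuous_intros)
    then show ?thesis
      unfolding F_def P_def uniformly_convergent_uniform_limit_iff .
  qed
  define q :: "nat \<Rightarrow> complex poly" where "q n = (\<Prod>i<n. [:1 - of_real (p i), of_real (p i):]) *
     [:1 - of_real r / of_nat n, of_real r / of_nat n:] ^ n" for n :: nat
  have q: "poly (q n) x = P n x * (1 + of_real r * (x - 1) / of_nat n) ^ n" for n and x :: complex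
    unfolding q_def P_def poly_mult poly_prod poly_power
    by (simp add: algebra_simps diff_divide_distrib add_divide_distrib)
  have lin: "stable_poly [:1 - of_real a, of_real a:]" if "a \<ge> 0" for a :: real
    unfolding stable_poly_def
  proof (intro allI impI notI)
    fix x :: complex assume x: "Im x > 0" "poly [:1 - of_real a, of_real a:] x = 0"
    then have "Im (poly [:1 - of_real a, of_real a:] x) = 0" by simp
    then have "a = 0" using x(1) by simp
    with x(2) show False by simp
  qed
  have stable: "stable_poly (q n)" for n
    unfolding q_def stable_poly_mult_iff
    using lin[of "r / of_nat n"] r p(2) by (auto intro!: stable_poly_prod stable_poly_power lin)
  define f where "f x = F x * exp (of_real r * (x - 1))" for x
  have holF: "F holomorphic_on UNIV"
  proof (rule holomorphic_uniform_sequence)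
    show "P n holomorphic_on UNIV" for n unfolding P_def by (intro holomorphic_intros)
    show "\<exists>d>0. cball x d \<subseteq> UNIV \<and> uniform_limit (cball x d) P F sequentially" for x
      by (intro exI[of _ 1] conjI FK) auto
  qed auto
  have cF: "continuous_on A F" for A
    using holomorphic_on_imp_continuous_on[OF holF] continuous_on_subset by blast
  have "uniform_limit K (\<lambda>n x. poly (q n) x) f sequentially" if K: "compact K" for K
    unfolding q f_def
    by (intro uniform_lim_mult FK K exp_power_uniform_limit compact_imp_bounded
        compact_continuous_image cF continuous_intros)
  then have "t_stable f" unfolding t_stable_def using stable by blast
  moreover have "f holomorphic_on UNIV" unfolding f_def by (intro holomorphic_intros holF)
  moreover have "(\<lambda>n. P n x * exp (of_real r * (x - 1))) \<longlonglongrightarrow> f x" for x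
    unfolding f_def
    using tendsto_uniform_limitI[OF FK[of "{x}"]] by (intro tendsto_mult tendsto_const) auto
  ultimately show ?thesis using that unfolding P_def by blast
qed

section \<open>Probability generating functions\<close>

lemma integrable_measure_pmf_power:
  fixes x :: complex
  assumes "norm x \<le> 1"
  shows "integrable (measure_pmf \<nu>) (\<lambda>k. x ^ k)"
  by (rule measure_pmf.integrable_const_bound[where B = 1])
    (use assms in \<open>auto simp: norm_power power_le_one\<close>)

lemma pgf_sums:
  fixes x :: complex
  assumes "norm x \<le> 1"
  shows "(\<lambda>k. of_real (pmf \<nu> k) * x ^ k) sums (\<integral>k. x ^ k \<partial>measure_pmf \<nu>)"
proof -
  have "integrable (count_space UNIV) (\<lambda>k. pmf \<nu> k *\<^sub>R x ^ k)"
    using integrable_measure_pmf_power[OF assms, of \<nu>]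
    unfolding measure_pmf_eq_density by (subst (asm) integrable_density) auto
  from sums_integral_count_space_nat[OF this] show ?thesis
    unfolding measure_pmf_eq_density by (subst integral_density) (auto simp: scaleR_conv_of_real)
qed

lemma has_law_integral_power:
  fixes x :: complex
  assumes "has_law M Z \<nu>"
  shows "(\<integral>\<omega>. x ^ Z \<omega> \<partial>M) = (\<integral>k. x ^ k \<partial>measure_pmf \<nu>)"
proof -
  have "(\<integral>\<omega>. x ^ Z \<omega> \<partial>M) = (\<integral>k. x ^ k \<partial>distr M (count_space UNIV) Z)"
    by (rule integral_distr[symmetric]) (use assms in \<open>auto simp: has_law_def\<close>)
  then show ?thesis using assms by (simp add: has_law_def)
qed

lemma pgf_bernoulli:
  fixes x :: complex
  assumes "0 \<le> p" "p \<le> 1"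
  shows "(\<integral>k. x ^ k \<partial>measure_pmf (map_pmf of_bool (bernoulli_pmf p))) = 1 + of_real p * (x - 1)"
  using assms unfolding integral_map_pmf
  by (subst integral_measure_pmf[of UNIV]) (auto simp: UNIV_bool scaleR_conv_of_real algebra_simps)

lemma pgf_poisson:
  fixes x :: complex
  assumes "0 \<le> r" "norm x \<le> 1"
  shows "(\<integral>k. x ^ k \<partial>measure_pmf (if r = 0 then return_pmf 0 else poisson_pmf r)) = exp (of_real r * (x - 1))"
proof (cases "r = 0")
  case False
  with assms have r: "0 < r" by simp
  have "(\<lambda>k. (of_real r * x) ^ k /\<^sub>R fact k * exp (- of_real r)) sums (exp (of_real r * x) * exp (- of_real r))"
    by (intro sums_mult2 exp_converges)
  moreover have "(of_real r * x) ^ k /\<^sub>R fact k * exp (- of_real r) = of_real (pmf (poisson_pmf r) k) * x ^ k" for k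
    using r by (simp add: scaleR_conv_of_real power_mult_distrib field_simps exp_of_real[symmetric] del: exp_of_real)
  ultimately have "(\<lambda>k. of_real (pmf (poisson_pmf r) k) * x ^ k) sums exp (of_real r * (x - 1))"
    by (simp add: mult_exp_exp algebra_simps)
  with pgf_sums[OF assms(2), of "poisson_pmf r"] False show ?thesis
    using sums_unique2 by fastforce
qed simp

lemma pmf_eqI_pgf:
  fixes \<mu> \<nu> :: "nat pmf"
  assumes "\<And>t::real. 0 < t \<Longrightarrow> t < 1 \<Longrightarrow>
    (\<integral>k. of_real t ^ k \<partial>measure_pmf \<mu>) = (\<integral>k. complex_of_real t ^ k \<partial>measure_pmf \<nu>)"
  shows "\<mu> = \<nu>"
proof -
  have "(\<lambda>k. complex_of_real (pmf \<mu> k)) = (\<lambda>k. complex_of_real (pmf \<nu> k))"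
    by (rule power_series_coeffs_unique[OF pgf_sums pgf_sums assms]) auto
  then have "pmf \<mu> k = pmf \<nu> k" for k by (metis of_real_eq_iff)
  then show ?thesis by (rule pmf_eqI)
qed

section \<open>Generating functions of Bernoulli-Poisson sums\<close>

text \<open>
  In a discrete space the net of finite partial sums converges only if it is eventually constant.
\<close>

lemma nat_summable_on_finite_support:
  fixes f :: "'b \<Rightarrow> nat"
  assumes "f summable_on I"
  shows "finite {i \<in> I. f i \<noteq> 0}"
proof -
  from assms obtain S where "(sum f \<longlongrightarrow> S) (finite_subsets_at_top I)"
    unfolding summable_on_def has_sum_def by blast
  then have "eventually (\<lambda>F. sum f F \<in> {S}) (finite_subsets_at_top I)"
    using topological_tendstoD[of "sum f" S _ "{S}"] by (simp add: Topological_Spaces.open_discrete)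
  then obtain F where F: "finite F" "F \<subseteq> I" "\<And>G. finite G \<Longrightarrow> F \<subseteq> G \<Longrightarrow> G \<subseteq> I \<Longrightarrow> sum f G = S"
    unfolding eventually_finite_subsets_at_top by auto
  have zero: "f i = 0" if "i \<in> I - F" for i
    using F(3)[of F] F(3)[of "insert i F"] F(1,2) that by (auto simp: insert_subset)
  have "{i \<in> I. f i \<noteq> 0} \<subseteq> F"
  proof
    fix i assume "i \<in> {i \<in> I. f i \<noteq> 0}"
    with zero[of i] show "i \<in> F" by auto
  qed
  then show ?thesis using F(1) finite_subset by blast
qed

lemma eventually_eq_0_iff_finite_support:
  "eventually (\<lambda>n. f n = 0) sequentially \<longleftrightarrow> finite {n. f n \<noteq> 0}"
  by (simp only: cofinite_eq_sequentially[symmetric] eventually_cofinite)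

lemma nat_summable_on_infsum_eventually:
  fixes f :: "nat \<Rightarrow> nat"
  assumes "finite {i \<in> I. f i \<noteq> 0}"
  shows "f summable_on I"
    and "eventually (\<lambda>n. (\<Sum>i\<in>I \<inter> {..<n}. f i) = (\<Sum>\<^sub>\<infinity>i\<in>I. f i)) sequentially"
proof -
  let ?A = "{i \<in> I. f i \<noteq> 0}"
  show "f summable_on I"
    using summable_on_finite[OF assms, of f] by (rule summable_on_cong_neutral[THEN iffD1, rotated -1]) auto
  have inf: "(\<Sum>\<^sub>\<infinity>i\<in>I. f i) = sum f ?A"
    using infsum_finite[OF assms, of f] by (subst infsum_cong_neutral[of ?A I f f]) auto
  obtain m where m: "?A \<subseteq> {..<m}" using finite_nat_bounded[OF assms] by blast
  show "eventually (\<lambda>n. (\<Sum>i\<in>I \<inter> {..<n}. f i) = (\<Sum>\<^sub>\<infinity>i\<in>I. f i)) sequentially"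
    using eventually_ge_at_top[of m]
  proof eventually_elim
    case (elim n)
    have "sum f ?A = (\<Sum>i\<in>I \<inter> {..<n}. f i)"
      by (rule sum.mono_neutral_left) (use m elim in auto)
    then show ?case using inf by simp
  qed
qed

text \<open>
  Independence factorises the expectation of \<open>x\<close> raised to the partial sums. Almost surely these
  partial sums are eventually equal to the whole sum, and \<open>x\<close> raised to them is bounded by \<open>1\<close>, so
  dominated convergence applies.
\<close>

lemma (in prob_space) bernoulli_poisson_pgf_limit:
  fixes x :: complex
  assumes X: "\<And>i. i \<in> I \<Longrightarrow> has_law M (X i) (map_pmf of_bool (bernoulli_pmf (p i)))"
    and p: "\<And>i. 0 \<le> p i" "\<And>i. p i \<le> 1" "\<And>i. i \<notin> I \<Longrightarrow> p i = 0"
    and Y: "has_law M Y (if r = 0 then return_pmf 0 else poisson_pmf r)" and r: "0 \<le> r"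
    and indep: "indep_vars (\<lambda>_. count_space UNIV) (case_option Y X) (insert None (Some ` I))"
    and summable: "AE \<omega> in M. (\<lambda>i. X i \<omega>) summable_on I"
    and law: "has_law M (\<lambda>\<omega>. (\<Sum>\<^sub>\<infinity>i\<in>I. X i \<omega>) + Y \<omega>) \<mu>"
    and x: "norm x \<le> 1"
  shows "(\<lambda>n. (\<Prod>i<n. 1 + of_real (p i) * (x - 1)) * exp (of_real r * (x - 1)))
    \<longlonglongrightarrow> (\<integral>k. x ^ k \<partial>measure_pmf \<mu>)"
proof -
  define Z where "Z = case_option Y X"
  define A where "A n = insert None (Some ` (I \<inter> {..<n}))" for n :: nat
  have Z_meas: "Z j \<in> measurable M (count_space UNIV)" if "j \<in> insert None (Some ` I)" for j
    using that X Y unfolding Z_def has_law_def by auto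
  have meas: "(\<lambda>\<omega>. x ^ Z j \<omega>) \<in> borel_measurable M" if "j \<in> insert None (Some ` I)" for j
    using measurable_compose[OF Z_meas[OF that], of "\<lambda>k. x ^ k" borel] by simp
  have integrable: "integrable M (\<lambda>\<omega>. x ^ Z j \<omega>)" if "j \<in> insert None (Some ` I)" for j
    by (rule integrable_const_bound[where B = 1])
      (use meas[OF that] x in \<open>auto simp: norm_power power_le_one\<close>)
  have A_sub: "A n \<subseteq> insert None (Some ` I)" and A_fin: "finite (A n)" for n
    by (auto simp: A_def)
  have prodA: "(\<Prod>j\<in>A n. g j) = g None * (\<Prod>i\<in>I \<inter> {..<n}. g (Some i))" for g :: "nat option \<Rightarrow> complex" and n
    unfolding A_def by (subst prod.insert) (auto simp: prod.reindex)
  have int: "(\<integral>\<omega>. (\<Prod>j\<in>A n. x ^ Z j \<omega>) \<partial>M) = (\<Prod>i<n. 1 + of_real (p i) * (x - 1)) * exp (of_real r * (x - 1))" for n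
  proof -
    have "indep_vars (\<lambda>_. borel) (\<lambda>j \<omega>. x ^ Z j \<omega>) (A n)"
      by (rule indep_vars_compose2[OF indep_vars_subset[OF indep A_sub], folded Z_def]) simp
    then have "(\<integral>\<omega>. (\<Prod>j\<in>A n. x ^ Z j \<omega>) \<partial>M) = (\<Prod>j\<in>A n. \<integral>\<omega>. x ^ Z j \<omega> \<partial>M)"
      by (intro indep_vars_lebesgue_integral A_fin integrable subsetD[OF A_sub])
    also have "\<dots> = (\<integral>\<omega>. x ^ Y \<omega> \<partial>M) * (\<Prod>i\<in>I \<inter> {..<n}. \<integral>\<omega>. x ^ X i \<omega> \<partial>M)"
      unfolding prodA by (simp add: Z_def)
    also have "(\<integral>\<omega>. x ^ Y \<omega> \<partial>M) = exp (of_real r * (x - 1))"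
      unfolding has_law_integral_power[OF Y] by (rule pgf_poisson[OF r x])
    also have "(\<Prod>i\<in>I \<inter> {..<n}. \<integral>\<omega>. x ^ X i \<omega> \<partial>M) = (\<Prod>i\<in>I \<inter> {..<n}. 1 + of_real (p i) * (x - 1))"
      using has_law_integral_power[OF X] pgf_bernoulli[OF p(1,2)] by (intro prod.cong) auto
    also have "\<dots> = (\<Prod>i<n. 1 + of_real (p i) * (x - 1))"
      by (rule prod.mono_neutral_left) (use p(3) in auto)
    finally show ?thesis by (simp add: mult.commute)
  qed
  let ?S = "\<lambda>\<omega>. (\<Sum>\<^sub>\<infinity>i\<in>I. X i \<omega>) + Y \<omega>"
  have "(\<lambda>n. \<integral>\<omega>. (\<Prod>j\<in>A n. x ^ Z j \<omega>) \<partial>M) \<longlonglongrightarrow> (\<integral>\<omega>. x ^ ?S \<omega> \<partial>M)"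
  proof (rule integral_dominated_convergence[where w = "\<lambda>_. 1"])
    have "?S \<in> measurable M (count_space UNIV)" using law by (simp add: has_law_def)
    from measurable_compose[OF this, of "\<lambda>k. x ^ k" borel]
    show "(\<lambda>\<omega>. x ^ ?S \<omega>) \<in> borel_measurable M" by simp
    show "(\<lambda>\<omega>. \<Prod>j\<in>A n. x ^ Z j \<omega>) \<in> borel_measurable M" for n
      by (intro borel_measurable_prod meas subsetD[OF A_sub])
    show "AE \<omega> in M. norm (\<Prod>j\<in>A n. x ^ Z j \<omega>) \<le> 1" for n
      using x by (auto simp: prod_norm[symmetric] norm_power intro!: prod_le_1 power_le_one)
    show "AE \<omega> in M. (\<lambda>n. \<Prod>j\<in>A n. x ^ Z j \<omega>) \<longlonglongrightarrow> x ^ ?S \<omega>"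
      using summable
    proof eventually_elim
      case (elim \<omega>)
      have prod_power: "(\<Prod>j\<in>A n. x ^ Z j \<omega>) = x ^ Y \<omega> * x ^ (\<Sum>i\<in>I \<inter> {..<n}. X i \<omega>)" for n
        by (simp add: prodA Z_def power_sum)
      have "eventually (\<lambda>n. (\<Sum>i\<in>I \<inter> {..<n}. X i \<omega>) = (\<Sum>\<^sub>\<infinity>i\<in>I. X i \<omega>)) sequentially"
        by (rule nat_summable_on_infsum_eventually(2)[OF nat_summable_on_finite_support[OF elim]])
      then have "eventually (\<lambda>n. (\<Prod>j\<in>A n. x ^ Z j \<omega>) = x ^ ?S \<omega>) sequentially"
        by eventually_elim (simp add: prod_power power_add)
      then show ?case by (rule tendsto_eventually)
    qed
  qed simp
  then show ?thesis unfolding int has_law_integral_power[OF law] .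
qed

text \<open>
  The generating function does not vanish at \<open>1/2\<close>, so the parameters are summable and the product
  formula extends from the unit disc to an entire t-stable function with the same power series.
\<close>

lemma bernoulli_poisson_sum_imp_t_stable:
  assumes "bernoulli_poisson_sum M I X Y \<mu>"
  shows "t_stable_pmf \<mu>"
proof -
  from assms interpret prob_space M by (simp add: bernoulli_poisson_sum_def)
  have "\<forall>i\<in>I. \<exists>q. 0 \<le> q \<and> q \<le> 1 \<and> has_law M (X i) (map_pmf of_bool (bernoulli_pmf q))"
    using assms unfolding bernoulli_poisson_sum_def bernoulli_rv_def Bex_def atLeastAtMost_iff by blast
  then obtain p' where p': "\<And>i. i \<in> I \<Longrightarrow> 0 \<le> p' i \<and> p' i \<le> 1 \<and> has_law M (X i) (map_pmf of_bool (bernoulli_pmf (p' i)))"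
    by metis
  define p where "p i = (if i \<in> I then p' i else 0)" for i
  have p: "0 \<le> p i" "p i \<le> 1" for i using p' by (auto simp: p_def)
  obtain r where r: "0 \<le> r" "has_law M Y (if r = 0 then return_pmf 0 else poisson_pmf r)"
    using assms unfolding bernoulli_poisson_sum_def poisson_rv_def by auto
  define G where "G x = (\<integral>k. x ^ k \<partial>measure_pmf \<mu>)" for x :: complex
  have lim: "(\<lambda>n. (\<Prod>i<n. 1 + of_real (p i) * (x - 1)) * exp (of_real r * (x - 1))) \<longlonglongrightarrow> G x"
    if "norm x \<le> 1" for x
    unfolding G_def
    by (rule bernoulli_poisson_pgf_limit[of I X p Y r])
      (use assms p p' r that in \<open>auto simp: p_def bernoulli_poisson_sum_def\<close>)
  have sums: "(\<lambda>k. of_real (pmf \<mu> k) * x ^ k) sums G x" if "norm x \<le> 1" for x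
    unfolding G_def by (rule pgf_sums[OF that])
  have "summable p"
  proof -
    let ?P = "\<lambda>n. \<Prod>i<n. 1 + p i * (1/2 - 1)"
    have Ghalf: "G (1/2) \<noteq> 0"
    proof
      assume "G (1/2) = 0"
      then have "(\<lambda>k. complex_of_real (pmf \<mu> k * (1/2) ^ k)) sums of_real 0"
        using sums[of "1/2"] by simp
      then have *: "(\<lambda>k. pmf \<mu> k * (1/2) ^ k) sums 0" by (simp only: sums_of_real_iff)
      then have "pmf \<mu> k * (1/2) ^ k = 0" for k
        using suminf_eq_zero_iff[OF sums_summable[OF *]] sums_unique[OF *] by simp
      then have "pmf \<mu> k = 0" for k by simp
      then show False using set_pmf_not_empty[of \<mu>] by (auto simp: set_pmf_eq)
    qed
    have "(\<lambda>n. complex_of_real (?P n * exp (r * (1/2 - 1)))) \<longlonglongrightarrow> G (1/2)"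
      using lim[of "1/2"] by (simp flip: exp_of_real)
    from tendsto_inverse[OF this Ghalf]
    have "Bseq (\<lambda>n. inverse (complex_of_real (?P n * exp (r * (1/2 - 1)))))"
      by (intro convergent_imp_Bseq convergentI)
    then obtain K where K: "\<And>n. norm (inverse (complex_of_real (?P n * exp (r * (1/2 - 1))))) \<le> K"
      by (auto simp: Bseq_def)
    have "(\<Sum>i<n. p i) \<le> 2 * K" for n
    proof -
      have "(\<Sum>i<n. p i) / 2 \<le> exp ((\<Sum>i<n. p i) / 2)"
        using exp_ge_add_one_self[of "(\<Sum>i<n. p i) / 2"] by linarith
      also have "\<dots> \<le> inverse (?P n)" by (rule exp_half_sum_le_inverse_prod[OF p(2)])
      also have "\<dots> \<le> inverse (?P n * exp (r * (1/2 - 1)))"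
      proof -
        have "0 < ?P n" 
        proof (rule prod_pos)
          show "0 < 1 + p i * (1/2 - 1)" for i using p(2)[of i] by (simp add: algebra_simps)
        qed
        moreover from this have "?P n * exp (r * (1/2 - 1)) \<le> ?P n * 1"
          using r by (intro mult_left_mono) auto
        ultimately show ?thesis by (intro le_imp_inverse_le) auto
      qed
      also have "\<dots> \<le> norm (inverse (complex_of_real (?P n * exp (r * (1/2 - 1)))))"
        by (metis abs_ge_self norm_of_real of_real_inverse)
      also have "\<dots> \<le> K" by (rule K)
      finally show ?thesis by linarith
    qed
    then show ?thesis by (rule summableI_nonneg_bounded[OF p(1)])
  qed
  then obtain f where f: "t_stable f" "f holomorphic_on UNIV"
    "\<And>x. (\<lambda>n. (\<Prod>i<n. 1 + of_real (p i) * (x - 1)) * exp (of_real r * (x - 1))) \<longlonglongrightarrow> f x"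
    by (rule t_stable_bernoulli_poisson[OF _ p(1) r(1)]) (rule that; blast)
  have Gf: "G x = f x" if "norm x \<le> 1" for x
    using LIMSEQ_unique[OF lim[OF that] f(3)] .
  have taylor: "(\<lambda>n. (deriv ^^ n) f 0 / fact n * x ^ n) sums f x" for x
    using holomorphic_power_series[of f 0 "norm x + 1" x] holomorphic_on_subset[OF f(2)] by simp
  have "(\<lambda>n. (deriv ^^ n) f 0 / fact n) = (\<lambda>k. complex_of_real (pmf \<mu> k))"
    by (rule power_series_coeffs_unique[OF taylor sums]) (use Gf in auto)
  then have "(\<lambda>k. of_real (pmf \<mu> k) * x ^ k) sums f x" for x
    using taylor[of x] by (simp add: fun_eq_iff)
  then show ?thesis using f(1) unfolding t_stable_pmf_def by blast
qed

section \<open>Bernoulli-Poisson sums with prescribed parameters\<close>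

text \<open>
  On a countable discrete space the points of measure zero form a null set, which is what a
  probability measure needs in order to be a probability mass function.
\<close>

lemma exists_has_law:
  fixes S :: "'a \<Rightarrow> nat"
  assumes "prob_space M" and S: "S \<in> measurable M (count_space UNIV)"
  obtains \<nu> where "has_law M S \<nu>"
proof -
  define N where "N = distr M (count_space UNIV) S"
  interpret N: prob_space N
    unfolding N_def by (rule prob_space.prob_space_distr[OF assms])
  have setsN: "sets N = UNIV" by (simp add: N_def)
  have "(\<Union>x\<in>{x. measure N {x} = 0}. {x}) \<in> null_sets N"
    by (rule null_sets_UN') (auto simp: null_sets_def setsN N.emeasure_eq_measure)
  then have "AE x in N. measure N {x} \<noteq> 0"
    by (rule AE_I') auto
  then have "measure_pmf (Abs_pmf N) = N"
    using setsN N.prob_space_axioms by (intro Abs_pmf_inverse) auto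
  then show ?thesis using that[of "Abs_pmf N"] S by (simp add: has_law_def N_def)
qed

text \<open>
  The coordinates of a product space are independent with the prescribed laws, and by the first
  Borel-Cantelli lemma almost surely only finitely many of the Bernoulli coordinates are non-zero.
\<close>

lemma exists_bernoulli_poisson_sum:
  assumes p: "\<And>i. 0 \<le> p i" "\<And>i. p i \<le> 1" "summable p" and r: "0 \<le> r"
  obtains M :: "(nat option \<Rightarrow> nat) measure" and X Y \<nu>
  where "bernoulli_poisson_sum M UNIV X Y \<nu>"
    "\<And>i. has_law M (X i) (map_pmf of_bool (bernoulli_pmf (p i)))"
    "has_law M Y (if r = 0 then return_pmf 0 else poisson_pmf r)"
proof -
  define L where "L j = (case j of None \<Rightarrow> (if r = 0 then return_pmf 0 else poisson_pmf r)
     | Some i \<Rightarrow> map_pmf (of_bool :: bool \<Rightarrow> nat) (bernoulli_pmf (p i)))" for j :: "nat option"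
  define M where "M = PiM UNIV (\<lambda>j. measure_pmf (L j))"
  define X where "X i \<omega> = \<omega> (Some i)" for i and \<omega> :: "nat option \<Rightarrow> nat"
  define Y where "Y \<omega> = \<omega> None" for \<omega> :: "nat option \<Rightarrow> nat"
  interpret prob_space M
    unfolding M_def by (intro prob_space_PiM measure_pmf.prob_space_axioms)
  have meas: "(\<lambda>\<omega>. \<omega> j) \<in> measurable M (count_space UNIV)" for j
  proof -
    have "(\<lambda>\<omega>. \<omega> j) \<in> measurable M (measure_pmf (L j))"
      unfolding M_def by (rule measurable_component_singleton) simp
    moreover have "measurable M (measure_pmf (L j)) = measurable M (count_space UNIV)"
      by (rule measurable_cong_sets) simp_all
    ultimately show ?thesis by simp
  qed
  have distr: "distr M (count_space UNIV) (\<lambda>\<omega>. \<omega> j) = measure_pmf (L j)" for j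
  proof -
    have "distr M (count_space UNIV) (\<lambda>\<omega>. \<omega> j) = distr M (measure_pmf (L j)) (\<lambda>\<omega>. \<omega> j)"
      by (rule distr_cong) auto
    also have "\<dots> = measure_pmf (L j)"
      unfolding M_def by (rule distr_PiM_component) (auto intro: measure_pmf.prob_space_axioms)
    finally show ?thesis .
  qed
  have law: "has_law M (\<lambda>\<omega>. \<omega> j) (L j)" for j
    unfolding has_law_def using meas distr by blast
  have lawX: "has_law M (X i) (map_pmf of_bool (bernoulli_pmf (p i)))" for i
    using law[of "Some i"] by (simp add: L_def X_def[abs_def])
  have lawY: "has_law M Y (if r = 0 then return_pmf 0 else poisson_pmf r)"
    using law[of None] by (simp add: L_def Y_def[abs_def])
  have coords: "case_option Y X = (\<lambda>j \<omega>. \<omega> j)"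
    by (auto simp: fun_eq_iff X_def Y_def split: option.split)
  have "indep_vars (\<lambda>_. count_space UNIV) (case_option Y X) UNIV"
    unfolding coords
  proof (subst indep_vars_iff_distr_eq_PiM')
    have "sets M = sets (PiM UNIV (\<lambda>_. count_space UNIV))"
      unfolding M_def by (rule sets_PiM_cong) auto
    then have "distr M (PiM UNIV (\<lambda>_. count_space UNIV)) (\<lambda>\<omega>. \<omega>) = M"
      by (intro distr_id2) simp
    then show "distr M (PiM UNIV (\<lambda>_. count_space UNIV)) (\<lambda>\<omega>. \<lambda>j\<in>UNIV. \<omega> j) =
        PiM UNIV (\<lambda>j. distr M (count_space UNIV) (\<lambda>\<omega>. \<omega> j))"
      by (simp add: distr M_def[symmetric] restrict_UNIV)
  qed (use meas in auto)
  then have indep: "indep_vars (\<lambda>_. count_space UNIV) (case_option Y X) (insert None (Some ` UNIV))"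
    by (simp add: UNIV_option_conv[symmetric])
  have X_meas[measurable]: "X i \<in> measurable M (count_space UNIV)" for i
    using lawX by (simp add: has_law_def)
  have Y_meas[measurable]: "Y \<in> measurable M (count_space UNIV)"
    using lawY by (simp add: has_law_def)
  define A where "A n = {\<omega> \<in> space M. X n \<omega> \<noteq> 0}" for n
  have A[measurable]: "A n \<in> sets M" for n unfolding A_def by measurable
  have "measure M (A n) = p n" for n
  proof -
    have "measure M (A n) = measure (distr M (count_space UNIV) (X n)) (- {0})"
      by (subst measure_distr) (auto simp: A_def vimage_def intro!: arg_cong[of _ _ "measure M"])
    also have "\<dots> = measure (map_pmf (of_bool :: bool \<Rightarrow> nat) (bernoulli_pmf (p n))) (- {0})"
      using lawX[of n] by (simp add: has_law_def)
    also have "\<dots> = measure (bernoulli_pmf (p n)) {True}"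
    proof -
      have "(of_bool :: bool \<Rightarrow> nat) -` (- {0}) = {True}"
        by (auto simp: of_bool_def split: if_splits)
      then show ?thesis by (simp only: measure_map_pmf)
    qed
    also have "\<dots> = p n" using p by (simp add: measure_pmf_single)
    finally show ?thesis .
  qed
  then have "AE \<omega> in M. eventually (\<lambda>n. \<omega> \<in> space M - A n) sequentially"
    using p(3) by (intro borel_cantelli_AE1 A) (auto simp: less_top[symmetric])
  then have AE: "AE \<omega> in M. (\<lambda>i. X i \<omega>) summable_on UNIV"
  proof eventually_elim
    case (elim \<omega>)
    then have "eventually (\<lambda>n. X n \<omega> = 0) sequentially"
      by eventually_elim (auto simp: A_def)
    then have "finite {n. X n \<omega> \<noteq> 0}"
      by (simp only: eventually_eq_0_iff_finite_support)
    then show ?case by (intro nat_summable_on_infsum_eventually(1)) simp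
  qed
  have sum_meas: "(\<lambda>\<omega>. \<Sum>\<^sub>\<infinity>i. X i \<omega>) \<in> measurable M (count_space UNIV)"
  proof -
    \<comment> \<open>On the event where the sum diverges, \<open>infsum\<close> is \<open>0\<close> by convention; \<open>T\<close> respects that, so it converges everywhere.\<close>
    define T where "T n \<omega> = (if \<exists>m. \<forall>i\<ge>m. X i \<omega> = 0 then \<Sum>i<n. X i \<omega> else 0)" for n \<omega>
    have [measurable]: "T n \<in> measurable M (count_space UNIV)" for n
      unfolding T_def by measurable
    have T_lim: "eventually (\<lambda>n. T n \<omega> = (\<Sum>\<^sub>\<infinity>i. X i \<omega>)) sequentially" for \<omega>
    proof (cases "finite {i. X i \<omega> \<noteq> 0}")
      case True
      then have "eventually (\<lambda>i. X i \<omega> = 0) sequentially"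
        by (simp only: eventually_eq_0_iff_finite_support)
      then have "\<exists>m. \<forall>i\<ge>m. X i \<omega> = 0" by (simp add: eventually_sequentially)
      then have "T n \<omega> = (\<Sum>i<n. X i \<omega>)" for n by (simp add: T_def)
      then show ?thesis
        using nat_summable_on_infsum_eventually(2)[of UNIV "\<lambda>i. X i \<omega>"] True
        by simp
    next
      case False
      then have "\<not> eventually (\<lambda>i. X i \<omega> = 0) sequentially"
        by (simp only: eventually_eq_0_iff_finite_support not_False_eq_True)
      then have "\<not> (\<exists>m. \<forall>i\<ge>m. X i \<omega> = 0)" by (simp add: eventually_sequentially)
      then have "T n \<omega> = 0" for n unfolding T_def by (rule if_not_P)
      moreover have "(\<Sum>\<^sub>\<infinity>i. X i \<omega>) = 0"
        using nat_summable_on_finite_support[of "\<lambda>i. X i \<omega>" UNIV] False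
        by (intro infsum_not_exists) auto
      ultimately show ?thesis by simp
    qed
    have [measurable]: "(\<lambda>\<omega>. real (\<Sum>\<^sub>\<infinity>i. X i \<omega>)) \<in> borel_measurable M"
    proof (rule borel_measurable_LIMSEQ_metric)
      show "(\<lambda>\<omega>. real (T n \<omega>)) \<in> borel_measurable M" for n by measurable
      show "(\<lambda>n. real (T n \<omega>)) \<longlonglongrightarrow> real (\<Sum>\<^sub>\<infinity>i. X i \<omega>)" for \<omega>
        using T_lim[of \<omega>] by (intro tendsto_eventually) (auto elim: eventually_mono)
    qed
    have "{\<omega> \<in> space M. real (\<Sum>\<^sub>\<infinity>i. X i \<omega>) = real k} \<in> sets M" for k
      by measurable
    then show ?thesis
      by (subst measurable_count_space_eq2_countable) (auto simp: vimage_def Int_def conj_commute)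
  qed
  have "(\<lambda>\<omega>. (\<Sum>\<^sub>\<infinity>i. X i \<omega>) + Y \<omega>) \<in> measurable M (count_space UNIV)"
    using sum_meas by measurable
  then obtain \<nu> where \<nu>: "has_law M (\<lambda>\<omega>. (\<Sum>\<^sub>\<infinity>i. X i \<omega>) + Y \<omega>) \<nu>"
    using exists_has_law[OF prob_space_axioms] by blast
  have "bernoulli_poisson_sum M UNIV X Y \<nu>"
  proof -
    have "bernoulli_rv M (X i)" for i
      unfolding bernoulli_rv_def using lawX[of i] p(1,2)[of i] by (intro bexI[of _ "p i"]) auto
    moreover have "poisson_rv M Y"
      unfolding poisson_rv_def using lawY r by blast
    ultimately show ?thesis
      unfolding bernoulli_poisson_sum_def using prob_space_axioms indep AE \<nu> by blast
  qed
  then show ?thesis using that lawX lawY by blast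
qed

section \<open>Stable laws as Bernoulli-Poisson sums\<close>

text \<open>
  The normalised Jensen polynomials of the generating function are products of Bernoulli generating
  functions that converge to it.
\<close>

lemma t_stable_imp_pgf_factorization:
  assumes "t_stable_pmf \<mu>"
  obtains q :: "nat \<Rightarrow> real" and r where "\<And>i. 0 \<le> q i" "\<And>i. q i \<le> 1" "summable q" "0 \<le> r"
    "\<And>x. 0 < x \<Longrightarrow> x \<le> 1 \<Longrightarrow> (\<lambda>n. (\<Prod>i<n. 1 + q i * (x - 1)) * exp (r * (x - 1))) \<longlonglongrightarrow> (\<Sum>k. pmf \<mu> k * x ^ k)"
proof -
  obtain f where f: "t_stable f" "\<And>x. (\<lambda>k. of_real (pmf \<mu> k) * x ^ k) sums f x"
    using assms unfolding t_stable_pmf_def by blast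
  obtain k0 where k0: "pmf \<mu> k0 > 0"
    using set_pmf_not_empty[of \<mu>] by (auto simp: set_pmf_eq pmf_nonneg less_le)
  \<comment> \<open>The shift ensures that the degree bound exceeds \<open>k0\<close> for all \<open>n\<close>.\<close>
  define P where "P n = jensen_poly (pmf \<mu>) (n + Suc k0)" for n
  have roots: "w \<in> \<real>\<^sub>\<le>\<^sub>0" if "poly (P n) w = 0" for n w
    by (rule jensen_poly_root_nonpos_real[OF f, of k0]) (use k0 that in \<open>auto simp: P_def\<close>)
  have P1: "poly (P n) 1 \<noteq> 0" for n using roots[of n 1] by auto
  have "\<exists>p. decseq p \<and> (\<forall>i. 0 \<le> p i) \<and> (\<forall>i. p i \<le> 1) \<and> (\<forall>i\<ge>degree (P n). p i = 0) \<and>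
     (\<forall>x. poly (P n) x = poly (P n) 1 * (\<Prod>i<degree (P n). 1 + of_real (p i) * (x - 1)))" for n
    using bernoulli_factorization[of "P n"] roots[of n] P1[of n] by (metis poly_0)
  then obtain p where p: "\<And>n. decseq (p n)" "\<And>n i. 0 \<le> p n i" "\<And>n i. p n i \<le> 1"
    "\<And>n i. i \<ge> degree (P n) \<Longrightarrow> p n i = 0"
    "\<And>n x. poly (P n) x = poly (P n) 1 * (\<Prod>i<degree (P n). 1 + of_real (p n i) * (x - 1))"
    by metis
  define g where "g x = (\<Sum>k. pmf \<mu> k * x ^ k)" for x :: real
  have g: "(\<lambda>k. pmf \<mu> k * x ^ k) sums g x" for x
  proof -
    have "summable (\<lambda>k. complex_of_real (pmf \<mu> k * x ^ k))"
      using f(2)[of "of_real x"] by (simp add: sums_summable)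
    then show ?thesis unfolding g_def by (intro summable_sums) (simp only: summable_of_real_iff)
  qed
  have g1: "g 1 = 1"
  proof -
    have "(\<lambda>k. complex_of_real (pmf \<mu> k)) sums 1"
      using pgf_sums[of 1 \<mu>] by simp
    then have "(\<lambda>k. pmf \<mu> k) sums 1" by (metis of_real_1 sums_of_real_iff)
    then show ?thesis using g[of 1] sums_unique2 by fastforce
  qed
  have P_lim: "(\<lambda>n. poly (P n) (of_real x)) \<longlonglongrightarrow> of_real (g x)" if "0 \<le> x" for x
    unfolding P_def by (intro LIMSEQ_ignore_initial_segment jensen_poly_tendsto pmf_nonneg that g)
  have lim: "(\<lambda>n. \<Prod>i<degree (P n). 1 + p n i * (x - 1)) \<longlonglongrightarrow> g x" if "0 < x" "x \<le> 1" for x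
  proof -
    have "(\<lambda>n. poly (P n) (of_real x) / poly (P n) (of_real 1)) \<longlonglongrightarrow> of_real (g x) / of_real (g 1)"
      using that g1 by (intro tendsto_divide P_lim) auto
    moreover have "poly (P n) (of_real x) / poly (P n) (of_real 1) = of_real (\<Prod>i<degree (P n). 1 + p n i * (x - 1))" for n
      using p(5)[of n "of_real x"] P1[of n] by simp
    ultimately have "(\<lambda>n. complex_of_real (\<Prod>i<degree (P n). 1 + p n i * (x - 1))) \<longlonglongrightarrow> of_real (g x)"
      using g1 by simp
    then show ?thesis by (simp only: tendsto_of_real_iff)
  qed
  have "g (1/2) > 0"
    unfolding g_def using g[of "1/2"] k0
    by (intro suminf_pos2[of _ k0]) (auto dest: sums_summable)
  from bernoulli_products_limit[of p "\<lambda>n. degree (P n)" g, OF p(1-4) lim this]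
  show ?thesis using that unfolding g_def by blast
qed

theorem proposition3p7:
  fixes \<mu> :: "nat pmf"
  shows "(t_stable_pmf \<mu> \<longrightarrow>
           (\<exists>(M :: (nat option \<Rightarrow> nat) measure) I X Y. bernoulli_poisson_sum M I X Y \<mu>)) \<and>
         ((\<exists>(M :: 'a measure) I X Y. bernoulli_poisson_sum M I X Y \<mu>) \<longrightarrow> t_stable_pmf \<mu>)"
proof (intro conjI impI)
  assume "t_stable_pmf \<mu>"
  then obtain q :: "nat \<Rightarrow> real" and r where q: "\<And>i. 0 \<le> q i" "\<And>i. q i \<le> 1" "summable q" "0 \<le> r"
    and lim: "\<And>x. 0 < x \<Longrightarrow> x \<le> 1 \<Longrightarrow>
      (\<lambda>n. (\<Prod>i<n. 1 + q i * (x - 1)) * exp (r * (x - 1))) \<longlonglongrightarrow> (\<Sum>k. pmf \<mu> k * x ^ k)"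
    using t_stable_imp_pgf_factorization by blast
  obtain M :: "(nat option \<Rightarrow> nat) measure" and X Y \<nu> where M: "bernoulli_poisson_sum M UNIV X Y \<nu>"
    and X: "\<And>i. has_law M (X i) (map_pmf of_bool (bernoulli_pmf (q i)))"
    and Y: "has_law M Y (if r = 0 then return_pmf 0 else poisson_pmf r)"
    using exists_bernoulli_poisson_sum[of q r, OF q] by blast
  have "\<mu> = \<nu>"
  proof (rule pmf_eqI_pgf)
    fix t :: real assume t: "0 < t" "t < 1"
    from M interpret prob_space M by (simp add: bernoulli_poisson_sum_def)
    have "(\<lambda>n. (\<Prod>i<n. 1 + of_real (q i) * (of_real t - 1)) * exp (of_real r * (of_real t - 1)))
        \<longlonglongrightarrow> (\<integral>k. complex_of_real t ^ k \<partial>measure_pmf \<nu>)"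
      by (rule bernoulli_poisson_pgf_limit[of UNIV X q Y r])
        (use M X Y q t in \<open>auto simp: bernoulli_poisson_sum_def\<close>)
    moreover have "(\<Prod>i<n. 1 + of_real (q i) * (of_real t - 1)) * exp (of_real r * (of_real t - 1))
        = complex_of_real ((\<Prod>i<n. 1 + q i * (t - 1)) * exp (r * (t - 1)))" for n
      by (simp flip: exp_of_real)
    ultimately have lim_\<nu>: "(\<lambda>n. complex_of_real ((\<Prod>i<n. 1 + q i * (t - 1)) * exp (r * (t - 1))))
        \<longlonglongrightarrow> (\<integral>k. complex_of_real t ^ k \<partial>measure_pmf \<nu>)"
      by simp
    have lim_\<mu>: "(\<lambda>n. complex_of_real ((\<Prod>i<n. 1 + q i * (t - 1)) * exp (r * (t - 1))))
        \<longlonglongrightarrow> of_real (\<Sum>k. pmf \<mu> k * t ^ k)"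
      using lim t by (intro tendsto_of_real) auto
    have "(\<integral>k. complex_of_real t ^ k \<partial>measure_pmf \<mu>) = of_real (\<Sum>k. pmf \<mu> k * t ^ k)"
    proof -
      have *: "(\<lambda>k. complex_of_real (pmf \<mu> k * t ^ k)) sums (\<integral>k. complex_of_real t ^ k \<partial>measure_pmf \<mu>)"
        using pgf_sums[of "of_real t" \<mu>] t by simp
      then have "summable (\<lambda>k. pmf \<mu> k * t ^ k)"
        using sums_summable summable_of_real_iff by blast
      then have "(\<lambda>k. complex_of_real (pmf \<mu> k * t ^ k)) sums of_real (\<Sum>k. pmf \<mu> k * t ^ k)"
        by (intro sums_of_real summable_sums)
      with * show ?thesis using sums_unique2 by blast
    qed
    then show "(\<integral>k. complex_of_real t ^ k \<partial>measure_pmf \<mu>) = (\<integral>k. complex_of_real t ^ k \<partial>measure_pmf \<nu>)"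
      using LIMSEQ_unique[OF lim_\<mu> lim_\<nu>] by (rule trans)
  qed
  with M show "\<exists>(M :: (nat option \<Rightarrow> nat) measure) I X Y. bernoulli_poisson_sum M I X Y \<mu>" by blast
next
  assume "\<exists>(M :: 'a measure) I X Y. bernoulli_poisson_sum M I X Y \<mu>"
  then show "t_stable_pmf \<mu>" using bernoulli_poisson_sum_imp_t_stable by blast
qed

end
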